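(* For constrained persuasion there is a $2n$-approximation algorithm that runs in polynomial time, where $n=|\Theta|$ is the number of states of nature.
   Context: Constrained persuasion. An instance consists of a finite set $\Theta$ of $n$ states partitioned as $\Theta=\Theta_A\sqcup\Theta_R$ (acceptable and rejectable states), a finite set $\Sigma$ of signals, rational probabilities $q_\theta>0$ with $\sum_\theta q_\theta=1$, and a bipartite graph $H=(\Theta\cup\Sigma,E)$, $E\subseteq\Theta\times\Sigma$, without isolated vertices; $(\theta,\sigma)\in E$ means that $\sigma$ may be sent in state $\theta$, and $N(\cdot)$ denotes neighborhoods. The sender commits to a signaling scheme $\varphi:E\to[0,1]$ with $\sum_{\sigma\in N(\theta)}\varphi(\theta,\sigma)=q_\theta$ for all $\theta\in\Theta$. The receiver accepts on signal $\sigma$ if and only if $\sum_{\theta\in N(\sigma)\cap\Theta_A}\varphi(\theta,\sigma)\ge\sum_{\theta\in N(\sigma)\cap\Theta_R}\varphi(\theta,\sigma)$ (ties broken in favor of accepting); then $\sigma$ is an accept signal. The sender's utility is $\sum_{\sigma\text{ accept signal}}\sum_{\theta\in N(\sigma)}\varphi(\theta,\sigma)$. The goal is to find $\varphi$ maximizing it; let $\mathrm{OPT}$ be the maximum. A $\rho$-approximation algorithm outputs a signaling scheme with sender utility at least $\mathrm{OPT}/\rho$. *)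

theory Defs
  imports Complex_Main "HOL-Library.FuncSet" "HOL-Computational_Algebra.Polynomial"
begin

section \<open>Constrained persuasion\<close>

record ('s, 'g) persuasion =
  acceptable :: "'s set"
  rejectable :: "'s set"
  signals :: "'g set"
  prior :: "'s \<Rightarrow> rat"
  edges :: "('s \<times> 'g) set"

definition states :: "('s, 'g) persuasion \<Rightarrow> 's set" where
  "states I = acceptable I \<union> rejectable I"

definition persuasion_instance :: "('s, 'g) persuasion \<Rightarrow> bool" where
  "persuasion_instance I \<longleftrightarrow>
     finite (states I) \<and> finite (signals I) \<and>
     acceptable I \<inter> rejectable I = {} \<and>
     (\<forall>\<theta>\<in>states I. prior I \<theta> > 0) \<and> (\<Sum>\<theta>\<in>states I. prior I \<theta>) = 1 \<and>
     edges I \<subseteq> states I \<times> signals I \<and>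
     (\<forall>\<theta>\<in>states I. \<exists>\<sigma>. (\<theta>, \<sigma>) \<in> edges I) \<and>
     (\<forall>\<sigma>\<in>signals I. \<exists>\<theta>. (\<theta>, \<sigma>) \<in> edges I)"

definition nb_state :: "('s, 'g) persuasion \<Rightarrow> 's \<Rightarrow> 'g set" where
  "nb_state I \<theta> = {\<sigma>. (\<theta>, \<sigma>) \<in> edges I}"

definition nb_signal :: "('s, 'g) persuasion \<Rightarrow> 'g \<Rightarrow> 's set" where
  "nb_signal I \<sigma> = {\<theta>. (\<theta>, \<sigma>) \<in> edges I}"

text \<open>A scheme is a function on the edge set; its values elsewhere are never used.\<close>

definition signaling_scheme :: "('s, 'g) persuasion \<Rightarrow> ('s \<times> 'g \<Rightarrow> real) \<Rightarrow> bool" where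
  "signaling_scheme I \<phi> \<longleftrightarrow>
     \<phi> \<in> edges I \<rightarrow> {0..1} \<and>
     (\<forall>\<theta>\<in>states I. (\<Sum>\<sigma>\<in>nb_state I \<theta>. \<phi> (\<theta>, \<sigma>)) = of_rat (prior I \<theta>))"

definition accept_signals :: "('s, 'g) persuasion \<Rightarrow> ('s \<times> 'g \<Rightarrow> real) \<Rightarrow> 'g set" where
  "accept_signals I \<phi> = {\<sigma>\<in>signals I.
     (\<Sum>\<theta>\<in>nb_signal I \<sigma> \<inter> acceptable I. \<phi> (\<theta>, \<sigma>))
       \<ge> (\<Sum>\<theta>\<in>nb_signal I \<sigma> \<inter> rejectable I. \<phi> (\<theta>, \<sigma>))}"

definition sender_utility :: "('s, 'g) persuasion \<Rightarrow> ('s \<times> 'g \<Rightarrow> real) \<Rightarrow> real" where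
  "sender_utility I \<phi> = (\<Sum>\<sigma>\<in>accept_signals I \<phi>. \<Sum>\<theta>\<in>nb_signal I \<sigma>. \<phi> (\<theta>, \<sigma>))"

text \<open>The supremum ranges over all real-valued schemes, although algorithms output rational
  ones.  It is a maximum: for each of the finitely many sets of signals, the schemes under which
  all of these signals are accepted form a compact polytope, on which the mass sent along them
  attains its maximum, and \<open>OPT\<close> is the largest of these maxima.\<close>

definition OPT :: "('s, 'g) persuasion \<Rightarrow> real" where
  "OPT I = (SUP \<phi> \<in> {\<phi>. signaling_scheme I \<phi>}. sender_utility I \<phi>)"


section \<open>Model of computation\<close>

text \<open>Algorithms are WHILE programs over binary trees, as in Jones, \<^emph>\<open>Computability and Complexity
  from a Programming Perspective\<close>.  The time measure is not Jones's unit cost, under which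
  repeated execution of \<open>X := Node X X\<close> builds a tree of exponential size in linear time.  Here
  every operator is charged the full size of the tree it yields, as if trees were copied and
  never shared.  Hence the contents of all variables stay bounded by input size plus time, and
  time is polynomially related to the running time of Turing machines.\<close>

datatype tree = Leaf | Node tree tree

fun tsize :: "tree \<Rightarrow> nat" where
  "tsize Leaf = 1"
| "tsize (Node a b) = 1 + tsize a + tsize b"

fun left :: "tree \<Rightarrow> tree" where
  "left Leaf = Leaf"
| "left (Node a b) = a"

fun right :: "tree \<Rightarrow> tree" where
  "right Leaf = Leaf"
| "right (Node a b) = b"

type_synonym store = "nat \<Rightarrow> tree"

datatype expr = Var nat | LeafE | NodeE expr expr | LeftE expr | RightE expr

fun val :: "expr \<Rightarrow> store \<Rightarrow> tree" where
  "val (Var x) s = s x"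
| "val LeafE s = Leaf"
| "val (NodeE a b) s = Node (val a s) (val b s)"
| "val (LeftE a) s = left (val a s)"
| "val (RightE a) s = right (val a s)"

fun cost :: "expr \<Rightarrow> store \<Rightarrow> nat" where
  "cost (Var x) s = tsize (s x)"
| "cost LeafE s = 1"
| "cost (NodeE a b) s = cost a s + cost b s + tsize (Node (val a s) (val b s))"
| "cost (LeftE a) s = cost a s + tsize (left (val a s))"
| "cost (RightE a) s = cost a s + tsize (right (val a s))"

datatype prog =
    Assign nat expr
  | Seq prog prog
  | If expr prog prog
  | While expr prog

text \<open>\<open>exec c s t s'\<close>: started in \<open>s\<close>, the program \<open>c\<close> terminates in \<open>s'\<close> after time \<open>t\<close>.
  A test succeeds if its value is not \<open>Leaf\<close>.\<close>

inductive exec :: "prog \<Rightarrow> store \<Rightarrow> nat \<Rightarrow> store \<Rightarrow> bool" where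
  Assign: "exec (Assign x e) s (1 + cost e s) (s(x := val e s))"
| Seq: "exec c1 s1 t1 s2 \<Longrightarrow> exec c2 s2 t2 s3 \<Longrightarrow> exec (Seq c1 c2) s1 (t1 + t2) s3"
| IfTrue: "val e s \<noteq> Leaf \<Longrightarrow> exec c1 s t s' \<Longrightarrow> exec (If e c1 c2) s (1 + cost e s + t) s'"
| IfFalse: "val e s = Leaf \<Longrightarrow> exec c2 s t s' \<Longrightarrow> exec (If e c1 c2) s (1 + cost e s + t) s'"
| WhileFalse: "val e s = Leaf \<Longrightarrow> exec (While e c) s (1 + cost e s) s"
| WhileTrue: "val e s1 \<noteq> Leaf \<Longrightarrow> exec c s1 t1 s2 \<Longrightarrow> exec (While e c) s2 t2 s3
    \<Longrightarrow> exec (While e c) s1 (1 + cost e s1 + t1 + t2) s3"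

text \<open>Variable \<open>0\<close> holds the input at the start and the output at the end.\<close>

definition runs :: "prog \<Rightarrow> tree \<Rightarrow> tree \<Rightarrow> nat \<Rightarrow> bool" where
  "runs c x y t \<longleftrightarrow> (\<exists>s. exec c ((\<lambda>_. Leaf)(0 := x)) t s \<and> s 0 = y)"

definition polynomial_time_on :: "tree set \<Rightarrow> prog \<Rightarrow> bool" where
  "polynomial_time_on X c \<longleftrightarrow>
     (\<exists>p :: nat poly. \<forall>x\<in>X. \<exists>y t. runs c x y t \<and> t \<le> poly p (tsize x))"

inductive_cases AssignE: "exec (Assign x e) s t s'"
inductive_cases SeqE: "exec (Seq c1 c2) s t s'"
inductive_cases IfE: "exec (If e c1 c2) s t s'"
inductive_cases WhileE: "exec (While e c) s t s'"

lemma exec_deterministic: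
  "exec c s t s' \<Longrightarrow> exec c s u s'' \<Longrightarrow> t = u \<and> s' = s''"
proof (induction arbitrary: u s'' rule: exec.induct)
  case (Assign x e s)
  from Assign show ?case by (rule AssignE) simp
next
  case (Seq c1 s1 t1 s2 c2 t2 s3)
  from Seq.prems obtain u1 u2 r where "exec c1 s1 u1 r" "exec c2 r u2 s''" "u = u1 + u2"
    by (rule SeqE)
  then show ?case using Seq.IH by metis
next
  case (IfTrue e s c1 t s' c2)
  from IfTrue.prems obtain v where "exec c1 s v s''" "u = 1 + cost e s + v"
    by (rule IfE) (use IfTrue.hyps in simp_all)
  then show ?case using IfTrue.IH by metis
next
  case (IfFalse e s c2 t s' c1)
  from IfFalse.prems obtain v where "exec c2 s v s''" "u = 1 + cost e s + v"
    by (rule IfE) (use IfFalse.hyps in simp_all)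
  then show ?case using IfFalse.IH by metis
next
  case (WhileFalse e s c)
  from WhileFalse.prems show ?case
    by (rule WhileE) (use WhileFalse.hyps in simp_all)
next
  case (WhileTrue e s1 c t1 s2 t2 s3)
  from WhileTrue.prems obtain u1 u2 r
    where "exec c s1 u1 r" "exec (While e c) r u2 s''" "u = 1 + cost e s1 + u1 + u2"
    by (rule WhileE) (use WhileTrue.hyps in simp_all)
  then show ?case using WhileTrue.IH by metis
qed

lemma runs_deterministic: "runs c x y t \<Longrightarrow> runs c x y' t' \<Longrightarrow> y = y' \<and> t = t'"
  unfolding runs_def using exec_deterministic by blast

lemma tsize_val_le_cost: "tsize (val e s) \<le> cost e s"
  by (cases e) auto

lemma exec_tsize_le: "exec c s t s' \<Longrightarrow> tsize (s' x) \<le> tsize (s x) + t"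
proof (induction rule: exec.induct)
  case (Assign y e s)
  show ?case using tsize_val_le_cost[of e s] by simp
qed auto


section \<open>Encoding of instances and schemes\<close>

fun enc_bool :: "bool \<Rightarrow> tree" where
  "enc_bool False = Leaf"
| "enc_bool True = Node Leaf Leaf"

fun enc_list :: "tree list \<Rightarrow> tree" where
  "enc_list [] = Leaf"
| "enc_list (x # xs) = Node x (enc_list xs)"

text \<open>Binary notation, least significant bit first.\<close>

fun enc_nat :: "nat \<Rightarrow> tree" where
  "enc_nat n = (if n = 0 then Leaf else Node (enc_bool (odd n)) (enc_nat (n div 2)))"

declare enc_nat.simps [simp del]

text \<open>A fraction in lowest terms; used for non-negative rationals only.\<close>

definition enc_rat :: "rat \<Rightarrow> tree" where
  "enc_rat r = Node (enc_nat (nat (fst (quotient_of r)))) (enc_nat (nat (snd (quotient_of r))))"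

text \<open>The lists \<open>ss\<close> and \<open>gs\<close> enumerate the states and the signals.  The graph is given by its
  adjacency matrix, one row per state; since there are no isolated vertices, this is polynomially
  equivalent to a list of edges.\<close>

definition enumerates :: "('s, 'g) persuasion \<Rightarrow> 's list \<Rightarrow> 'g list \<Rightarrow> bool" where
  "enumerates I ss gs \<longleftrightarrow>
     distinct ss \<and> set ss = states I \<and> distinct gs \<and> set gs = signals I"

definition enc_instance :: "('s, 'g) persuasion \<Rightarrow> 's list \<Rightarrow> 'g list \<Rightarrow> tree" where
  "enc_instance I ss gs = enc_list (map (\<lambda>\<theta>.
     Node (enc_bool (\<theta> \<in> acceptable I))
       (Node (enc_rat (prior I \<theta>))
         (enc_list (map (\<lambda>\<sigma>. enc_bool ((\<theta>, \<sigma>) \<in> edges I)) gs)))) ss)"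

definition enc_scheme ::
    "('s, 'g) persuasion \<Rightarrow> 's list \<Rightarrow> 'g list \<Rightarrow> ('s \<times> 'g \<Rightarrow> rat) \<Rightarrow> tree" where
  "enc_scheme I ss gs \<psi> = enc_list (map (\<lambda>\<theta>. enc_list (map (\<lambda>\<sigma>.
     enc_rat (if (\<theta>, \<sigma>) \<in> edges I then \<psi> (\<theta>, \<sigma>) else 0)) gs)) ss)"


section \<open>Approximation algorithms\<close>

text \<open>Labelling states and signals by natural numbers is no restriction, as labels do not enter
  the encoding.\<close>

definition valid_inputs :: "tree set" where
  "valid_inputs = {enc_instance I ss gs | (I :: (nat, nat) persuasion) ss gs.
     persuasion_instance I \<and> enumerates I ss gs}"

text \<open>The approximation ratio may depend on the instance.\<close>

definition approximation_algorithm :: "((nat, nat) persuasion \<Rightarrow> real) \<Rightarrow> prog \<Rightarrow> bool" where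
  "approximation_algorithm \<rho> c \<longleftrightarrow>
     (\<forall>I ss gs. persuasion_instance I \<and> enumerates I ss gs \<longrightarrow>
       (\<exists>\<psi> t. runs c (enc_instance I ss gs) (enc_scheme I ss gs \<psi>) t \<and>
          signaling_scheme I (\<lambda>e. of_rat (\<psi> e)) \<and>
          sender_utility I (\<lambda>e. of_rat (\<psi> e)) \<ge> OPT I / \<rho> I))"

end

theory Submission
  imports Defs
begin

text \<open>Let \<open>A \<sigma>\<close> be the prior mass of the acceptable neighbours of a signal \<open>\<sigma>\<close>, and \<open>R \<sigma>\<close> the
  mass of the rejectable states whose only neighbour is \<open>\<sigma>\<close>.  If some scheme makes \<open>\<sigma>\<close> an accept
  signal, then \<open>R \<sigma> \<le> A \<sigma>\<close>.  Let \<open>b\<close> maximise \<open>A\<close> among the signals with \<open>R \<sigma> \<le> A \<sigma>\<close>.  Sending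
  all acceptable neighbours of \<open>b\<close> to \<open>b\<close>, and rejectable states to \<open>b\<close> only if they are forced,
  yields utility at least \<open>A b\<close>.  Conversely, along accept signals the rejectable mass is at most
  the acceptable mass, and an acceptable state that contributes has an accept signal \<open>\<sigma>\<close> among its
  neighbours, so its prior is at most \<open>A \<sigma> \<le> A b\<close>.  Hence \<open>OPT \<le> 2 * n * A b\<close>.

  The program is not written down explicitly: the functions on trees that have a polynomial-time
  program are closed under composition, pairing, case distinction and folds whose accumulator stays
  polynomially bounded, and the algorithm is a function built by these operations.\<close>

section \<open>Polynomially bounded and polynomial-time functions\<close>

text \<open>Coefficients are natural numbers, so no term can decrease. This is what allows bounds to
  be substituted into one another.\<close>

lemma poly_nat_mono: "x \<le> y \<Longrightarrow> poly (p :: nat poly) x \<le> poly p y"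
  by (induct p) (auto intro!: add_mono mult_mono)

lemma tsize_pos [simp]: "0 < tsize t"
  by (cases t) auto

lemma tsize_left: "tsize (left t) \<le> tsize t"
  by (cases t) auto

lemma tsize_right: "tsize (right t) \<le> tsize t"
  by (cases t) auto

definition pbounded :: "(tree \<Rightarrow> nat) \<Rightarrow> bool" where
  "pbounded g \<longleftrightarrow> (\<exists>p. \<forall>x. g x \<le> poly p (tsize x))"

lemma pboundedI: "(\<And>x. g x \<le> poly p (tsize x)) \<Longrightarrow> pbounded g"
  unfolding pbounded_def by blast

lemma pbounded_mono: "pbounded h \<Longrightarrow> (\<And>x. g x \<le> h x) \<Longrightarrow> pbounded g"
  unfolding pbounded_def by (meson order_trans)

lemma pbounded_const: "pbounded (\<lambda>x. n)"
  by (rule pboundedI[where p = "[:n:]"]) simp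

lemma pbounded_tsize: "pbounded tsize"
  by (rule pboundedI[where p = "[:0, 1:]"]) simp

lemma pbounded_add: "pbounded f \<Longrightarrow> pbounded g \<Longrightarrow> pbounded (\<lambda>x. f x + g x)"
proof -
  assume "pbounded f" "pbounded g"
  then obtain p q where "\<And>x. f x \<le> poly p (tsize x)" "\<And>x. g x \<le> poly q (tsize x)"
    unfolding pbounded_def by blast
  then show ?thesis
    by (intro pboundedI[where p = "p + q"]) (simp add: add_mono)
qed

lemma pbounded_mult: "pbounded f \<Longrightarrow> pbounded g \<Longrightarrow> pbounded (\<lambda>x. f x * g x)"
proof -
  assume "pbounded f" "pbounded g"
  then obtain p q where "\<And>x. f x \<le> poly p (tsize x)" "\<And>x. g x \<le> poly q (tsize x)"
    unfolding pbounded_def by blast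
  then show ?thesis
    by (intro pboundedI[where p = "p * q"]) (simp add: mult_le_mono)
qed

lemma pbounded_poly: "pbounded f \<Longrightarrow> pbounded (\<lambda>x. poly p (f x))"
proof -
  assume "pbounded f"
  then obtain q where "\<And>x. f x \<le> poly q (tsize x)"
    unfolding pbounded_def by blast
  then show ?thesis
    by (intro pboundedI[where p = "pcompose p q"]) (simp add: poly_pcompose poly_nat_mono)
qed

lemma pbounded_comp:
  assumes "pbounded g" "pbounded (\<lambda>x. tsize (f x))"
  shows "pbounded (\<lambda>x. g (f x))"
proof -
  obtain p where "\<And>x. g x \<le> poly p (tsize x)"
    using assms(1) unfolding pbounded_def by blast
  then show ?thesis
    using pbounded_mono[OF pbounded_poly[OF assms(2), of p]] by simp
qed

text \<open>The programs work in any store and leave almost all variables alone, so that a program can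
  save intermediate results while it runs another one.\<close>

definition polytime :: "(tree \<Rightarrow> tree) \<Rightarrow> bool" where
  "polytime f \<longleftrightarrow> (\<exists>c m T. pbounded T \<and>
     (\<forall>s. \<exists>t s'. exec c s t s' \<and> s' 0 = f (s 0) \<and> (\<forall>v\<ge>m. s' v = s v) \<and> t \<le> T (s 0)))"

lemma polytimeI:
  assumes "pbounded T"
    and "\<And>s. \<exists>t s'. exec c s t s' \<and> s' 0 = f (s 0) \<and> (\<forall>v\<ge>m. s' v = s v) \<and> t \<le> T (s 0)"
  shows "polytime f"
  using assms unfolding polytime_def by blast

text \<open>The threshold \<open>m\<close> can be raised freely: a program that leaves all variables
  from \<open>m\<close> on alone also leaves those from any larger \<open>n\<close> on alone. Hence
  several programs can share one threshold.\<close>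

lemma polytimeE:
  assumes "polytime f"
  obtains c m T where "pbounded T"
    "\<And>s n. n \<ge> m \<Longrightarrow>
       \<exists>t s'. exec c s t s' \<and> s' 0 = f (s 0) \<and> (\<forall>v\<ge>n. s' v = s v) \<and> t \<le> T (s 0)"
proof -
  obtain c m T where T: "pbounded T" and
    ex: "\<And>s. \<exists>t s'. exec c s t s' \<and> s' 0 = f (s 0) \<and> (\<forall>v\<ge>m. s' v = s v) \<and> t \<le> T (s 0)"
    using assms unfolding polytime_def by blast
  have "\<exists>t s'. exec c s t s' \<and> s' 0 = f (s 0) \<and> (\<forall>v\<ge>n. s' v = s v) \<and> t \<le> T (s 0)"
    if "n \<ge> m" for s n
  proof -
    obtain t s' where "exec c s t s'" "s' 0 = f (s 0)" "\<forall>v\<ge>m. s' v = s v" "t \<le> T (s 0)"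
      using ex[of s] by blast
    with that show ?thesis by (intro exI[of _ t] exI[of _ s']) auto
  qed
  with T show thesis by (rule that)
qed

text \<open>By \<open>exec_tsize_le\<close> a program cannot produce more than its input size plus
  its running time. Output sizes therefore never need a separate hypothesis.\<close>

lemma polytime_pbounded:
  assumes "polytime f"
  shows "pbounded (\<lambda>x. tsize (f x))"
proof -
  obtain c m T where T: "pbounded T" and ex: "\<And>s n. n \<ge> m \<Longrightarrow>
      \<exists>t s'. exec c s t s' \<and> s' 0 = f (s 0) \<and> (\<forall>v\<ge>n. s' v = s v) \<and> t \<le> T (s 0)"
    using assms by (rule polytimeE) blast
  have "tsize (f x) \<le> tsize x + T x" for x
  proof -
    obtain t s' where "exec c (\<lambda>_. x) t s'" "s' 0 = f x" "t \<le> T x"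
      using ex[of m "\<lambda>_. x"] by auto
    then show ?thesis
      using exec_tsize_le[of c "\<lambda>_. x" t s' 0] by simp
  qed
  then show ?thesis
    using pbounded_mono[OF pbounded_add[OF pbounded_tsize T]] by simp
qed

text \<open>Specialises from arbitrary stores to the initial store of \<open>runs\<close> and makes
  the time bound an explicit polynomial.\<close>

lemma polytime_runs:
  assumes "polytime f"
  obtains c p where "\<And>x. \<exists>t. runs c x (f x) t \<and> t \<le> poly p (tsize x)"
proof -
  obtain c m T where T: "pbounded T" and c: "\<And>s n. n \<ge> m \<Longrightarrow>
      \<exists>t s'. exec c s t s' \<and> s' 0 = f (s 0) \<and> (\<forall>v\<ge>n. s' v = s v) \<and> t \<le> T (s 0)"
    using assms by (rule polytimeE) blast
  obtain p where p: "\<And>x. T x \<le> poly p (tsize x)"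
    using T unfolding pbounded_def by blast
  have "\<exists>t. runs c x (f x) t \<and> t \<le> poly p (tsize x)" for x
  proof -
    obtain t s' where "exec c ((\<lambda>_. Leaf)(0 := x)) t s'" "s' 0 = f x" "t \<le> T x"
      using c[of m "(\<lambda>_. Leaf)(0 := x)"] by auto
    then show ?thesis unfolding runs_def using p[of x] order_trans by blast
  qed
  then show thesis by (rule that)
qed

lemma polytime_comp_pbounded: "pbounded g \<Longrightarrow> polytime f \<Longrightarrow> pbounded (\<lambda>x. g (f x))"
  using pbounded_comp polytime_pbounded by blast

lemma polytime_expr:
  assumes "\<And>s. val e s = f (s 0)" "\<And>s. cost e s \<le> T (s 0)" "pbounded T"
  shows "polytime f"
proof (rule polytimeI[where c = "Assign 0 e" and T = "\<lambda>x. 1 + T x" and m = 1])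
  show "pbounded (\<lambda>x. 1 + T x)"
    using assms(3) by (intro pbounded_add pbounded_const)
  show "\<exists>t s'. exec (Assign 0 e) s t s' \<and> s' 0 = f (s 0) \<and> (\<forall>v\<ge>1. s' v = s v) \<and> t \<le> 1 + T (s 0)"
      for s
    by (intro exI conjI, rule exec.Assign) (use assms(1,2) in auto)
qed

lemma polytime_id: "polytime (\<lambda>x. x)"
  by (rule polytime_expr[where e = "Var 0" and T = tsize]) (auto intro: pbounded_tsize)

lemma polytime_Leaf: "polytime (\<lambda>x. Leaf)"
  by (rule polytime_expr[where e = LeafE and T = "\<lambda>_. 1"]) (auto intro: pbounded_const)

lemma polytime_comp:
  assumes "polytime g" "polytime f"
  shows "polytime (\<lambda>x. g (f x))"
proof -
  obtain c m T where T: "pbounded T" and c: "\<And>s n. n \<ge> m \<Longrightarrow>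
      \<exists>t s'. exec c s t s' \<and> s' 0 = f (s 0) \<and> (\<forall>v\<ge>n. s' v = s v) \<and> t \<le> T (s 0)"
    using assms(2) by (rule polytimeE) blast
  obtain d k U where U: "pbounded U" and d: "\<And>s n. n \<ge> k \<Longrightarrow>
      \<exists>t s'. exec d s t s' \<and> s' 0 = g (s 0) \<and> (\<forall>v\<ge>n. s' v = s v) \<and> t \<le> U (s 0)"
    using assms(1) by (rule polytimeE) blast
  show ?thesis
  proof (rule polytimeI[where c = "Seq c d" and m = "max m k" and T = "\<lambda>x. T x + U (f x)"])
    show "pbounded (\<lambda>x. T x + U (f x))"
      using T U assms(2) by (intro pbounded_add polytime_comp_pbounded[of U f])
    fix s
    obtain t s' where 1: "exec c s t s'" "s' 0 = f (s 0)" "\<forall>v\<ge>max m k. s' v = s v" "t \<le> T (s 0)"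
      using c[of "max m k" s] by auto
    obtain u s'' where 2: "exec d s' u s''" "s'' 0 = g (s' 0)" "\<forall>v\<ge>max m k. s'' v = s' v"
        "u \<le> U (s' 0)"
      using d[of "max m k" s'] by auto
    show "\<exists>t s'. exec (Seq c d) s t s' \<and> s' 0 = g (f (s 0)) \<and> (\<forall>v\<ge>max m k. s' v = s v)
        \<and> t \<le> T (s 0) + U (f (s 0))"
      by (intro exI conjI, rule exec.Seq[OF 1(1) 2(1)]) (use 1 2 in \<open>auto simp: add_mono\<close>)
  qed
qed

lemma polytime_left: "polytime f \<Longrightarrow> polytime (\<lambda>x. left (f x))"
proof (rule polytime_comp[where g = left])
  show "polytime left"
    by (rule polytime_expr[where e = "LeftE (Var 0)" and T = "\<lambda>x. tsize x + tsize x"])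
      (auto simp: tsize_left intro: pbounded_add pbounded_tsize)
qed

lemma polytime_right: "polytime f \<Longrightarrow> polytime (\<lambda>x. right (f x))"
proof (rule polytime_comp[where g = right])
  show "polytime right"
    by (rule polytime_expr[where e = "RightE (Var 0)" and T = "\<lambda>x. tsize x + tsize x"])
      (auto simp: tsize_right intro: pbounded_add pbounded_tsize)
qed

text \<open>The input must survive the first program, and the first result must survive the second.
  They are saved in variables \<open>n\<close> and \<open>Suc n\<close>, which lie beyond the reach
  of both programs.\<close>

lemma polytime_Node:
  assumes "polytime f" "polytime g"
  shows "polytime (\<lambda>x. Node (f x) (g x))"
proof -
  obtain c m T where T: "pbounded T" and c: "\<And>s n. n \<ge> m \<Longrightarrow>
      \<exists>t s'. exec c s t s' \<and> s' 0 = f (s 0) \<and> (\<forall>v\<ge>n. s' v = s v) \<and> t \<le> T (s 0)"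
    using assms(1) by (rule polytimeE) blast
  obtain d k U where U: "pbounded U" and d: "\<And>s n. n \<ge> k \<Longrightarrow>
      \<exists>t s'. exec d s t s' \<and> s' 0 = g (s 0) \<and> (\<forall>v\<ge>n. s' v = s v) \<and> t \<le> U (s 0)"
    using assms(2) by (rule polytimeE) blast
  \<comment> \<open>\<open>Suc\<close> keeps \<open>n\<close> positive, so that saving the input
    does not overwrite variable \<open>0\<close>.\<close>
  define n where "n = Suc (max m k)"
  have n: "m \<le> n" "k \<le> n" "0 < n" by (auto simp: n_def)
  define V where "V = (\<lambda>x. (1 + tsize x) + T x + (2 + 2 * tsize x + tsize (f x)) + U x
    + (2 + 2 * (tsize (f x) + tsize (g x))))"
  let ?p1 = "Assign n (Var 0)"
  let ?p2 = "Seq (Assign (Suc n) (Var 0)) (Assign 0 (Var n))"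
  let ?p3 = "Assign 0 (NodeE (Var (Suc n)) (Var 0))"
  show ?thesis
  proof (rule polytimeI[where c = "Seq ?p1 (Seq c (Seq ?p2 (Seq d ?p3)))" and m =
      "n + 2" and T = V])
    show "pbounded V" unfolding V_def
      using T U assms
      by (intro pbounded_add pbounded_mult pbounded_const pbounded_tsize polytime_pbounded)
    fix s :: store
    let ?s1 = "s(n := s 0)"
    obtain t s2 where 1: "exec c ?s1 t s2" "s2 0 = f (s 0)" "\<forall>v\<ge>n. s2 v = ?s1 v" "t \<le> T (s 0)"
      using c[OF n(1), of ?s1] n(3) by auto
    let ?s3 = "s2(Suc n := s2 0, 0 := s2 n)"
    have s3: "?s3 0 = s 0" "?s3 (Suc n) = f (s 0)" using 1 by auto
    obtain u s4 where 2: "exec d ?s3 u s4" "s4 0 = g (s 0)" "\<forall>v\<ge>n. s4 v = ?s3 v" "u \<le> U (s 0)"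
      using d[OF n(2), of ?s3] unfolding s3 by auto
    have e1: "exec ?p1 s (1 + tsize (s 0)) ?s1"
      using exec.Assign[of n "Var 0" s] by simp
    have e2: "exec ?p2 s2 ((1 + tsize (f (s 0))) + (1 + tsize (s 0))) ?s3"
      using exec.Seq[OF exec.Assign[of "Suc n" "Var 0" s2] exec.Assign[of 0 "Var n"]] 1(2,3) by simp
    have e3: "exec ?p3 s4 (2 + 2 * (tsize (f (s 0)) + tsize (g (s 0)))) (s4(0 :=
        Node (f (s 0)) (g (s 0))))"
      using exec.Assign[of 0 "NodeE (Var (Suc n)) (Var 0)" s4] 2 s3
          by (simp add: mult_2 algebra_simps)
    show "\<exists>t s'. exec (Seq ?p1 (Seq c (Seq ?p2 (Seq d ?p3)))) s t s' \<and>
       s' 0 = Node (f (s 0)) (g (s 0)) \<and> (\<forall>v\<ge>n + 2. s' v = s v) \<and> t \<le> V (s 0)"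
      by (intro exI conjI, rule exec.Seq[OF e1 exec.Seq[OF 1(1) exec.Seq[OF e2 exec.Seq[OF 2(1)
          e3]]]])
        (use 1 2 in \<open>auto simp: V_def\<close>)
  qed
qed

text \<open>A first program pairs the test value with the input. The branches then recover the input
  as the right half of the pair, so nothing has to be saved elsewhere.\<close>

lemma polytime_If_Leaf:
  assumes "polytime b" "polytime f" "polytime g"
  shows "polytime (\<lambda>x. if b x \<noteq> Leaf then f x else g x)"
proof -
  have p: "polytime (\<lambda>x. Node (b x) x)"
    by (intro polytime_Node assms polytime_id)
  obtain c m T where T: "pbounded T" and c: "\<And>s n. n \<ge> m \<Longrightarrow>
      \<exists>t s'. exec c s t s' \<and> s' 0 = Node (b (s 0)) (s 0) \<and> (\<forall>v\<ge>n. s' v = s v) \<and> t \<le> T (s 0)"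
    using p by (rule polytimeE) blast
  have q: "polytime (\<lambda>y. f (right y))" "polytime (\<lambda>y. g (right y))"
    by (intro polytime_comp[OF assms(2)] polytime_comp[OF assms(3)] polytime_right polytime_id)+
  obtain d k U where U: "pbounded U" and d: "\<And>s n. n \<ge> k \<Longrightarrow>
      \<exists>t s'. exec d s t s' \<and> s' 0 = f (right (s 0)) \<and> (\<forall>v\<ge>n. s' v = s v) \<and> t \<le> U (s 0)"
    using q(1) by (rule polytimeE) blast
  obtain e l V where V: "pbounded V" and e: "\<And>s n. n \<ge> l \<Longrightarrow>
      \<exists>t s'. exec e s t s' \<and> s' 0 = g (right (s 0)) \<and> (\<forall>v\<ge>n. s' v = s v) \<and> t \<le> V (s 0)"
    using q(2) by (rule polytimeE) blast
  define n where "n = max m (max k l)"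
  have n: "m \<le> n" "k \<le> n" "l \<le> n" by (auto simp: n_def)
  define W where "W = (\<lambda>x. T x + (2 + 2 * tsize (b x) + tsize x) + U (Node (b x) x)
      + V (Node (b x) x))"
  show ?thesis
  proof (rule polytimeI[where c = "Seq c (If (LeftE (Var 0)) d e)" and m = n and T = W])
    show "pbounded W" unfolding W_def
      by (intro pbounded_add pbounded_mult pbounded_const pbounded_tsize polytime_pbounded
          polytime_comp_pbounded[OF U p] polytime_comp_pbounded[OF V p] T assms(1))
    fix s :: store
    obtain t s1 where 1: "exec c s t s1" "s1 0 = Node (b (s 0)) (s 0)" "\<forall>v\<ge>n. s1 v = s v"
        "t \<le> T (s 0)"
      using c[OF n(1), of s] by auto
    obtain u s2 where 2: "exec d s1 u s2" "s2 0 = f (s 0)" "\<forall>v\<ge>n. s2 v = s1 v" "u \<le> U (s1 0)"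
      using d[OF n(2), of s1] unfolding 1(2) by auto
    obtain w s3 where 3: "exec e s1 w s3" "s3 0 = g (s 0)" "\<forall>v\<ge>n. s3 v = s1 v" "w \<le> V (s1 0)"
      using e[OF n(3), of s1] unfolding 1(2) by auto
    let ?e = "LeftE (Var 0)"
    show "\<exists>t s'. exec (Seq c (If ?e d e)) s t s' \<and>
       s' 0 = (if b (s 0) \<noteq> Leaf then f (s 0) else g (s 0)) \<and> (\<forall>v\<ge>n. s' v = s v) \<and> t \<le> W (s 0)"
    proof (cases "b (s 0) = Leaf")
      case True
      then have v: "val ?e s1 = Leaf" by (simp add: 1(2))
      show ?thesis
        by (intro exI conjI, rule exec.Seq[OF 1(1) exec.IfFalse[OF v 3(1)]])
          (use True 1 3 in \<open>auto simp: W_def\<close>)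
    next
      case False
      then have v: "val ?e s1 \<noteq> Leaf" by (simp add: 1(2))
      show ?thesis
        by (intro exI conjI, rule exec.Seq[OF 1(1) exec.IfTrue[OF v 2(1)]])
          (use False 1 2 in \<open>auto simp: W_def\<close>)
    qed
  qed
qed

section \<open>Trees as lists, and bounded folds\<close>

fun items :: "tree \<Rightarrow> tree list" where
  "items Leaf = []"
| "items (Node a l) = a # items l"

lemma items_enc_list [simp]: "items (enc_list xs) = xs"
  by (induct xs) auto

text \<open>Every tree is a list along its right spine, so \<open>items\<close> and
  \<open>enc_list\<close> are inverse bijections and folds make sense on arbitrary trees.\<close>

lemma enc_list_items [simp]: "enc_list (items t) = t"
  by (induct t) auto

lemma enc_list_eq_Leaf [simp]: "enc_list xs = Leaf \<longleftrightarrow> xs = []"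
  by (cases xs) auto

lemma length_items: "length (items t) < tsize t"
  by (induct t) auto

lemma tsize_item: "a \<in> set (items t) \<Longrightarrow> tsize a \<le> tsize t"
  by (induct t) auto

text \<open>The loop state is \<open>Node x (Node rest acc)\<close>; the input \<open>x\<close>
  stays available to every step. A polynomial-time step alone would not do, since iterating it may
  let the accumulator grow exponentially; \<open>bound\<close> therefore caps every intermediate
  value. A function of three arguments counts as polynomial-time if it is so on the nested pair of
  them.\<close>

lemma polytime_fold:
  assumes h: "polytime (\<lambda>y. h (left y) (left (right y)) (right (right y)))"
    and l: "polytime l" and i: "polytime i" and B: "pbounded B"
    and bound: "\<And>x k. k \<le> length (items (l x)) \<Longrightarrow>
      tsize (fold (h x) (take k (items (l x))) (i x)) \<le> B x"
  shows "polytime (\<lambda>x. fold (h x) (items (l x)) (i x))"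
proof -
  define H where "H = (\<lambda>y. h (left y) (left (right y)) (right (right y)))"
  \<comment> \<open>One round of the loop: the head of the remaining list is removed and fed to
    \<open>h\<close>.\<close>
  define step where "step = (\<lambda>y. Node (left y) (Node (right (left (right y)))
    (H (Node (left y) (Node (left (left (right y))) (right (right y)))))))"
  have step: "polytime step" unfolding step_def
    by (intro polytime_Node polytime_left polytime_right polytime_id
        polytime_comp[OF h[folded H_def]])
  obtain c m T where T: "pbounded T" and c: "\<And>s n. n \<ge> m \<Longrightarrow>
      \<exists>t s'. exec c s t s' \<and> s' 0 = step (s 0) \<and> (\<forall>v\<ge>n. s' v = s v) \<and> t \<le> T (s 0)"
    using step by (rule polytimeE) blast
  obtain p where p: "\<And>x. T x \<le> poly p (tsize x)"
    using T unfolding pbounded_def by blast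
  let ?e = "LeftE (RightE (Var 0))"
  \<comment> \<open>Time of one round on a loop state of size at most \<open>N\<close>: the three
    parts of the test cost at most \<open>N\<close> each, the body at most \<open>poly p N\<close>.
    One further \<open>D N\<close> below pays for the final failing test.\<close>
  define D where "D = (\<lambda>N. 1 + 3 * N + poly p N)"
  have loop: "\<exists>t s'. exec (While ?e c) s t s' \<and> s' 0 = Node x (Node Leaf (fold (h x) xs acc)) \<and>
      (\<forall>v\<ge>m. s' v = s v) \<and> t \<le> (length xs + 1) * D N"
    if "s 0 = Node x (Node (enc_list xs) acc)"
      "\<And>k. k \<le> length xs \<Longrightarrow> tsize (fold (h x) (take k xs) acc) \<le> K"
      "2 + tsize x + tsize (enc_list xs) + K \<le> N" for s x xs acc K N
    using that
  proof (induction xs arbitrary: s acc)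
    case Nil
    have "tsize acc \<le> K" using Nil(2)[of 0] by simp
    then have "1 + cost ?e s \<le> D N" using Nil(1,3) by (simp add: D_def)
    moreover have "exec (While ?e c) s (1 + cost ?e s) s"
      using Nil(1) by (intro exec.WhileFalse) simp
    ultimately show ?case
      using Nil(1) by (intro exI[of _ "1 + cost ?e s"] exI[of _ s]) simp
  next
    case (Cons a xs)
    have acc: "tsize acc \<le> K" using Cons.prems(2)[of 0] by simp
    obtain t s' where 1: "exec c s t s'" "s' 0 = step (s 0)" "\<forall>v\<ge>m. s' v = s v" "t \<le> T (s 0)"
      using c[of m s] by auto
    have s': "s' 0 = Node x (Node (enc_list xs) (h x a acc))"
      unfolding 1(2) by (simp add: Cons.prems(1) step_def H_def)
    have ih: "tsize (fold (h x) (take k xs) (h x a acc)) \<le> K" if "k \<le> length xs" for k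
      using Cons.prems(2)[of "Suc k"] that by simp
    have "2 + tsize x + tsize (enc_list xs) + K \<le> N"
      using Cons.prems(3) by simp
    from Cons.IH[of s' "h x a acc", OF s' ih this] obtain u s'' where
      2: "exec (While ?e c) s' u s''" "s'' 0 = Node x (Node Leaf (fold (h x) xs (h x a acc)))"
        "\<forall>v\<ge>m. s'' v = s' v" "u \<le> (length xs + 1) * D N"
      by auto
    have "tsize (s 0) \<le> N" using Cons.prems(1,3) acc by simp
    then have "t \<le> poly p N" using 1(4) p[of "s 0"] poly_nat_mono[of "tsize (s 0)" N p] by linarith
    moreover have "cost ?e s \<le> 3 * N" using Cons.prems(1,3) acc by simp
    ultimately have "1 + cost ?e s + t \<le> D N" unfolding D_def by linarith
    then have "1 + cost ?e s + t + u \<le> (length (a # xs) + 1) * D N"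
      using 2(4) by simp
    moreover have run: "exec (While ?e c) s (1 + cost ?e s + t + u) s''"
      using 1 2 Cons.prems(1) by (intro exec.WhileTrue) auto
    ultimately show ?case
      using 1(3) 2(2,3) by (intro exI[of _ "1 + cost ?e s + t + u"] exI[of _ s'']) simp
  qed
  have "polytime (\<lambda>x. Node x (Node (l x) (i x)))"
    by (intro polytime_Node polytime_id l i)
  then obtain d k U where U: "pbounded U" and d: "\<And>s n. n \<ge> k \<Longrightarrow>
      \<exists>t s'. exec d s t s' \<and> s' 0 = Node (s 0) (Node (l (s 0)) (i (s 0))) \<and> (\<forall>v\<ge>n. s' v = s v) \<and>
          t \<le> U (s 0)"
    by (rule polytimeE) blast
  define N where "N = (\<lambda>x. 2 + tsize x + tsize (l x) + B x)"
  define V where "V = (\<lambda>x. U x + (tsize (l x) + 1) * D (N x) + (6 + tsize x + 3 * B x))"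
  obtain n where n: "m \<le> n" "k \<le> n"
    using max.cobounded1 max.cobounded2 by blast
  let ?r = "RightE (RightE (Var 0))"
  show ?thesis
  proof (rule polytimeI[where c = "Seq d (Seq (While ?e c) (Assign 0 ?r))" and m = n and T = V])
    show "pbounded V" unfolding V_def D_def N_def
      by (intro pbounded_add pbounded_mult pbounded_const pbounded_tsize pbounded_poly
          polytime_pbounded U l B)
    fix s :: store
    let ?x = "s 0"
    obtain t s1 where 1: "exec d s t s1" "s1 0 = Node ?x (Node (l ?x) (i ?x))"
      "\<forall>v\<ge>n. s1 v = s v" "t \<le> U ?x"
      using d[OF n(2), of s] by auto
    obtain u s2 where 2: "exec (While ?e c) s1 u s2"
      "s2 0 = Node ?x (Node Leaf (fold (h ?x) (items (l ?x)) (i ?x)))"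
      "\<forall>v\<ge>m. s2 v = s1 v" "u \<le> (length (items (l ?x)) + 1) * D (N ?x)"
      using loop[of s1 ?x "items (l ?x)" "i ?x" "B ?x"
          "N ?x", unfolded enc_list_items, OF 1(2) bound]
      by (auto simp: N_def)
    have "u \<le> (tsize (l ?x) + 1) * D (N ?x)"
      using 2(4) length_items[of "l ?x"]
      by (meson add_le_mono1 less_imp_le mult_le_mono1 order_trans)
    moreover have "1 + cost ?r s2 \<le> 6 + tsize ?x + 3 * B ?x"
      using 2(2) bound[of "length (items (l ?x))" ?x] by simp
    ultimately have time: "t + (u + (1 + cost ?r s2)) \<le> V ?x"
      using 1(4) unfolding V_def by linarith
    show "\<exists>t s'. exec (Seq d (Seq (While ?e c) (Assign 0 ?r))) s t s' \<and>
       s' 0 = fold (h ?x) (items (l ?x)) (i ?x) \<and> (\<forall>v\<ge>n. s' v = s v) \<and> t \<le> V ?x"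
      by (intro exI conjI, rule exec.Seq[OF 1(1) exec.Seq[OF 2(1) exec.Assign]])
        (use 1 2 n time in auto)
  qed
qed

section \<open>Constants, Boolean connectives and case distinction\<close>

lemma polytime_const: "polytime (\<lambda>x. t)"
  by (induct t) (auto intro: polytime_Leaf polytime_Node)

lemma enc_bool_eq_Leaf [simp]: "enc_bool b = Leaf \<longleftrightarrow> \<not> b"
  by (cases b) auto

lemma tsize_enc_bool: "tsize (enc_bool b) \<le> 3"
  by (cases b) auto

lemma polytime_If:
  "polytime (\<lambda>x. enc_bool (P x)) \<Longrightarrow> polytime f \<Longrightarrow> polytime g \<Longrightarrow>
      polytime (\<lambda>x. if P x then f x else g x)"
  using polytime_If_Leaf[of "\<lambda>x. enc_bool (P x)" f g] by simp

lemma enc_bool_If: "enc_bool b = (if b then Node Leaf Leaf else Leaf)"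
  by (cases b) auto

lemma polytime_not_Leaf: "polytime f \<Longrightarrow> polytime (\<lambda>x. enc_bool (f x \<noteq> Leaf))"
  unfolding enc_bool_If by (intro polytime_If_Leaf polytime_const)

lemma polytime_Not: "polytime (\<lambda>x. enc_bool (P x)) \<Longrightarrow> polytime (\<lambda>x. enc_bool (\<not> P x))"
proof -
  assume P: "polytime (\<lambda>x. enc_bool (P x))"
  have "enc_bool (\<not> P x) = (if P x then Leaf else Node Leaf Leaf)" for x
    by simp
  then show ?thesis using polytime_If[OF P polytime_const polytime_const] by simp
qed

lemma polytime_conj:
  assumes "polytime (\<lambda>x. enc_bool (P x))" "polytime (\<lambda>x. enc_bool (Q x))"
  shows "polytime (\<lambda>x. enc_bool (P x \<and> Q x))"
proof -
  have "enc_bool (P x \<and> Q x) = (if P x then enc_bool (Q x) else Leaf)" for x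
    by simp
  then show ?thesis using polytime_If[OF assms polytime_Leaf] by simp
qed

lemma polytime_disj:
  assumes "polytime (\<lambda>x. enc_bool (P x))" "polytime (\<lambda>x. enc_bool (Q x))"
  shows "polytime (\<lambda>x. enc_bool (P x \<or> Q x))"
  using polytime_Not[OF polytime_conj[OF assms[THEN polytime_Not]]] by simp

lemma polytime_iff:
  assumes "polytime (\<lambda>x. enc_bool (P x))" "polytime (\<lambda>x. enc_bool (Q x))"
  shows "polytime (\<lambda>x. enc_bool (P x \<longleftrightarrow> Q x))"
proof -
  have "enc_bool (P x \<longleftrightarrow> Q x) = (if P x then enc_bool (Q x) else enc_bool (\<not> Q x))" for x
    by simp
  then show ?thesis using polytime_If[OF assms polytime_Not[OF assms(2)]] by simp
qed

section \<open>Folds with an invariant, and list operations\<close>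

text \<open>\<open>J x k acc\<close> describes the accumulator after \<open>k\<close> list entries.
  Indexing by \<open>k\<close> lets the size bound grow along the fold, while \<open>k\<close>
  itself stays below the size of the list.\<close>

lemma polytime_fold_inv:
  assumes h: "polytime (\<lambda>y. h (left y) (left (right y)) (right (right y)))"
    and l: "polytime l" and i: "polytime i" and B: "pbounded B"
    and inv0: "\<And>x. J x 0 (i x)"
    and step: "\<And>x k a acc. J x k acc \<Longrightarrow> k < tsize (l x) \<Longrightarrow> a \<in> set (items (l x)) \<Longrightarrow>
        J x (Suc k) (h x a acc)"
    and bound: "\<And>x k acc. J x k acc \<Longrightarrow> k \<le> tsize (l x) \<Longrightarrow> tsize acc \<le> B x"
  shows "polytime (\<lambda>x. fold (h x) (items (l x)) (i x))"
proof (rule polytime_fold[OF h l i B])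
  fix x k assume k: "k \<le> length (items (l x))"
  have "J x k (fold (h x) (take k (items (l x))) (i x))"
    using k
  proof (induction k)
    case 0
    then show ?case using inv0 by simp
  next
    case (Suc k)
    then show ?case using step[of x k _ "items (l x) ! k"] length_items[of "l x"]
      by (simp add: take_Suc_conv_app_nth)
  qed
  then show "tsize (fold (h x) (take k (items (l x))) (i x)) \<le> B x"
    using bound k length_items[of "l x"] by simp
qed

text \<open>The increment \<open>G x\<close> does not depend on the accumulator, so the increments
  add up to at most \<open>tsize (l x) * G x\<close>.\<close>

lemma polytime_fold_grow:
  assumes h: "polytime (\<lambda>y. h (left y) (left (right y)) (right (right y)))"
    and l: "polytime l" and i: "polytime i" and G: "pbounded G"
    and grow: "\<And>x a acc. a \<in> set (items (l x)) \<Longrightarrow> tsize (h x a acc) \<le> tsize acc + G x"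
  shows "polytime (\<lambda>x. fold (h x) (items (l x)) (i x))"
proof (rule polytime_fold_inv[OF h l i,
      where B = "\<lambda>x. tsize (i x) + tsize (l x) * G x" and J =
          "\<lambda>x k acc. tsize acc \<le> tsize (i x) + k * G x"])
  show "pbounded (\<lambda>x. tsize (i x) + tsize (l x) * G x)"
    by (intro pbounded_add pbounded_mult polytime_pbounded l i G)
  show "tsize (h x a acc) \<le> tsize (i x) + Suc k * G x"
    if "tsize acc \<le> tsize (i x) + k * G x" "a \<in> set (items (l x))" for x k a acc
    using grow[OF that(2), of acc] that(1) by simp
  show "tsize acc \<le> tsize (i x) + tsize (l x) * G x"
    if "tsize acc \<le> tsize (i x) + k * G x" "k \<le> tsize (l x)" for x k acc
    using that mult_le_mono1[OF that(2), of "G x"] by linarith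
qed simp

text \<open>Consing along a fold reverses the list. The order-preserving operations below therefore
  fold over a list that has been reversed first.\<close>

lemma fold_Node: "fold (\<lambda>a acc. Node a acc) xs (enc_list ys) = enc_list (rev xs @ ys)"
proof (induct xs arbitrary: ys)
  case (Cons a xs)
  then show ?case using Cons[of "a # ys"] by simp
qed simp

lemma polytime_rev:
  assumes "polytime l"
  shows "polytime (\<lambda>x. enc_list (rev (items (l x))))"
proof -
  have "polytime (\<lambda>x. fold (\<lambda>a acc. Node a acc) (items (l x)) Leaf)"
  proof (rule polytime_fold_grow[where G = "\<lambda>x. 1 + tsize (l x)"])
    show "pbounded (\<lambda>x. 1 + tsize (l x))"
      by (intro pbounded_add pbounded_const polytime_pbounded assms)
    show "tsize (Node a acc) \<le> tsize acc + (1 + tsize (l x))" if "a \<in> set (items (l x))" for x a acc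
      using tsize_item[OF that] by simp
  qed (intro polytime_Node polytime_left polytime_right polytime_id polytime_const assms)+
  then show ?thesis by (simp only: fold_Node[of _ "[]", simplified])
qed

lemma polytime_append:
  assumes "polytime f" "polytime g"
  shows "polytime (\<lambda>x. enc_list (items (f x) @ items (g x)))"
proof -
  have "polytime (\<lambda>x. fold (\<lambda>a acc. Node a acc) (items (enc_list (rev (items (f x))))) (g x))"
  proof (rule polytime_fold_grow[where G = "\<lambda>x. 1 + tsize (f x)"])
    show "pbounded (\<lambda>x. 1 + tsize (f x))"
      by (intro pbounded_add pbounded_const polytime_pbounded assms)
    show "tsize (Node a acc) \<le> tsize acc + (1 + tsize (f x))"
      if "a \<in> set (items (enc_list (rev (items (f x)))))" for x a acc
      using that tsize_item[of a "f x"] by simp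
  qed (intro polytime_Node polytime_left polytime_right polytime_id polytime_rev assms)+
  moreover have "fold (\<lambda>a acc. Node a acc) (items (enc_list (rev (items s)))) t =
      enc_list (items s @ items t)" for s t
    using fold_Node[of "rev (items s)" "items t"] by simp
  ultimately show ?thesis by (simp only:)
qed

text \<open>The mapped function may depend on the whole input \<open>x\<close>, which makes nested
  passes over rows and signals possible. The size of \<open>g x a\<close> is bounded without
  reference to the accumulator, as \<open>polytime_fold_grow\<close> requires.\<close>

lemma polytime_map:
  assumes g: "polytime (\<lambda>y. g (left y) (right y))" and l: "polytime l"
  shows "polytime (\<lambda>x. enc_list (map (g x) (items (l x))))"
proof -
  obtain p where p: "\<And>y. tsize (g (left y) (right y)) \<le> poly p (tsize y)"
    using polytime_pbounded[OF g] unfolding pbounded_def by blast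
  have "polytime (\<lambda>x. fold (\<lambda>a acc. Node (g x a) acc) (items (enc_list (rev (items (l x))))) Leaf)"
  proof (rule polytime_fold_grow[where G = "\<lambda>x. 1 + poly p (1 + tsize x + tsize (l x))"])
    show "pbounded (\<lambda>x. 1 + poly p (1 + tsize x + tsize (l x)))"
      by (intro pbounded_add pbounded_const pbounded_poly pbounded_tsize polytime_pbounded l)
    have "polytime (\<lambda>y. Node (left y) (left (right y)))"
      by (intro polytime_Node polytime_left polytime_right polytime_id)
    from polytime_comp[OF g this] have "polytime (\<lambda>y. g (left y) (left (right y)))"
      by simp
    then show "polytime (\<lambda>y. Node (g (left y) (left (right y))) (right (right y)))"
      by (rule polytime_Node) (intro polytime_right polytime_id)
    fix x a acc assume "a \<in> set (items (enc_list (rev (items (l x)))))"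
    then have "tsize (Node x a) \<le> 1 + tsize x + tsize (l x)"
      using tsize_item by simp
    then have "tsize (g x a) \<le> poly p (1 + tsize x + tsize (l x))"
      using p[of "Node x a"] poly_nat_mono[of "tsize (Node x a)"
          "1 + tsize x + tsize (l x)" p] by simp
    then show "tsize (Node (g x a) acc) \<le> tsize acc + (1 + poly p (1 + tsize x + tsize (l x)))"
      by simp
  qed (intro polytime_const polytime_rev l)+
  moreover have "fold (\<lambda>a acc. Node (f a) acc) xs (enc_list ys) = enc_list (rev (map f xs) @ ys)"
      for f :: "tree \<Rightarrow> tree" and xs ys
    using fold_Node[of "map f xs" ys] by (simp add: fold_map comp_def)
  from this[of _ _ "[]"] have "fold (\<lambda>a acc. Node (f a) acc) (rev xs) Leaf = enc_list (map f xs)"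
      for f :: "tree \<Rightarrow> tree" and xs
    by (simp add: rev_map)
  ultimately show ?thesis by simp
qed

lemma polytime_filter:
  assumes P: "polytime (\<lambda>y. enc_bool (P (left y) (right y)))" and l: "polytime l"
  shows "polytime (\<lambda>x. enc_list (filter (P x) (items (l x))))"
proof -
  have "polytime (\<lambda>x. fold (\<lambda>a acc. if P x a then Node a acc
      else acc) (items (enc_list (rev (items (l x))))) Leaf)"
  proof (rule polytime_fold_grow[where G = "\<lambda>x. 1 + tsize (l x)"])
    show "pbounded (\<lambda>x. 1 + tsize (l x))"
      by (intro pbounded_add pbounded_const polytime_pbounded l)
    have "polytime (\<lambda>y. Node (left y) (left (right y)))"
      by (intro polytime_Node polytime_left polytime_right polytime_id)
    from polytime_comp[OF P this] have "polytime (\<lambda>y. enc_bool (P (left y) (left (right y))))"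
      by simp
    then show "polytime (\<lambda>y. if P (left y) (left (right y))
        then Node (left (right y)) (right (right y)) else right (right y))"
      by (rule polytime_If) (intro polytime_Node polytime_left polytime_right polytime_id)+
    show "tsize (if P x a then Node a acc else acc) \<le> tsize acc + (1 + tsize (l x))"
      if "a \<in> set (items (enc_list (rev (items (l x)))))" for x a acc
      using that tsize_item[of a "l x"] by simp
  qed (intro polytime_const polytime_rev l)+
  moreover have "fold (\<lambda>a acc. if P x a then Node a acc else acc) xs (enc_list ys) =
      enc_list (rev (filter (P x) xs) @ ys)" for x xs ys
    by (induct xs arbitrary: ys) (auto simp flip: enc_list.simps)
  from this[of _ _ "[]"] have "fold (\<lambda>a acc. if P x a then Node a acc else acc) (rev xs) Leaf =
      enc_list (filter (P x) xs)" for x xs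
    by (simp flip: rev_filter)
  ultimately show ?thesis by simp
qed

lemma polytime_Bex:
  assumes "polytime (\<lambda>y. enc_bool (P (left y) (right y)))" "polytime l"
  shows "polytime (\<lambda>x. enc_bool (\<exists>a\<in>set (items (l x)). P x a))"
  using polytime_not_Leaf[OF polytime_filter[OF assms]] by (simp add: filter_empty_conv)

section \<open>Binary arithmetic\<close>

text \<open>Every tree is read as a binary number, a nonempty left subtree being the digit 1; \<open>enc_nat\<close>
  yields the representation without leading zeros.\<close>

fun nval :: "tree \<Rightarrow> nat" where
  "nval Leaf = 0"
| "nval (Node b t) = of_bool (b \<noteq> Leaf) + 2 * nval t"

lemma enc_nat_0 [simp]: "enc_nat 0 = Leaf"
  by (simp add: enc_nat.simps)

lemma nval_enc_nat [simp]: "nval (enc_nat n) = n"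
proof (induct n rule: less_induct)
  case (less n)
  show ?case
  proof (cases "n = 0")
    case False
    then show ?thesis using less[of "n div 2"] by (subst enc_nat.simps) auto
  qed simp
qed

text \<open>Prepending a least significant digit doubles the number and adds the digit. The
  exceptional case is the one that would create a leading zero.\<close>

lemma enc_nat_double:
  "enc_nat (of_bool b + 2 * n) = (if \<not> b \<and> n = 0 then Leaf else Node (enc_bool b) (enc_nat n))"
  by (subst enc_nat.simps) auto

lemma length_enc_nat: "n < 2 ^ k \<Longrightarrow> length (items (enc_nat n)) \<le> k"
proof (induct k arbitrary: n)
  case (Suc k)
  show ?case
  proof (cases "n = 0")
    case False
    then show ?thesis using Suc(1)[of "n div 2"] Suc(2) by (subst enc_nat.simps) auto
  qed simp
qed simp

text \<open>A digit costs one node and a bit of size at most 3.\<close>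

lemma tsize_enc_nat_length: "tsize (enc_nat n) \<le> 4 * length (items (enc_nat n)) + 1"
proof (induct n rule: less_induct)
  case (less n)
  show ?case
  proof (cases "n = 0")
    case False
    then show ?thesis using less[of "n div 2"] tsize_enc_bool[of "odd n"]
      by (subst (1 2) enc_nat.simps) (auto simp: algebra_simps)
  qed simp
qed

lemma tsize_enc_nat: "n < 2 ^ k \<Longrightarrow> tsize (enc_nat n) \<le> 4 * k + 1"
  using length_enc_nat[of n k] tsize_enc_nat_length[of n] by linarith

text \<open>Together with \<open>tsize_enc_nat\<close> this passes between sizes of trees and
  magnitudes of numbers, so that size bounds for arithmetic results reduce to inequalities between
  powers of two.\<close>

lemma nval_less: "nval t < 2 ^ tsize t"
proof (induct t)
  case (Node b t)
  have "nval (Node b t) < 2 * 2 ^ tsize t"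
    using Node(2) by simp
  also have "\<dots> \<le> 2 ^ tsize (Node b t)"
    by (simp add: power_add)
  finally show ?case .
qed simp

lemma nval_pos_iff: "0 < nval t \<longleftrightarrow> (\<exists>b\<in>set (items t). b \<noteq> Leaf)"
  by (induct t) auto

lemma tsize_left_right: "tsize (left t) + tsize (right t) \<le> tsize t + 1"
  by (cases t) auto

text \<open>Digits arrive least significant first, so a differing pair of digits overrides the
  verdict reached so far and an equal pair keeps it. At the end, a nonzero unread digit of
  \<open>g x\<close> settles the comparison.\<close>

lemma polytime_nval_le:
  assumes "polytime f" "polytime g"
  shows "polytime (\<lambda>x. enc_bool (nval (f x) \<le> nval (g x)))"
proof -
  \<comment> \<open>The accumulator holds the unread digits of \<open>g x\<close> and whether the digits of \<open>f x\<close> read so far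
    form a number at most that of the digits of \<open>g x\<close> read so far.\<close>
  define step where "step = (\<lambda>b acc. Node (right (left acc))
    (if b \<noteq> Leaf \<longleftrightarrow> left (left acc) \<noteq> Leaf then right acc else enc_bool (left (left acc) \<noteq> Leaf)))"
  define run where "run = (\<lambda>x. fold step (items (f x)) (Node (g x) (Node Leaf Leaf)))"
  have "polytime (\<lambda>x. fold ((\<lambda>x. step) x) (items (f x)) (Node (g x) (Node Leaf Leaf)))"
  proof (rule polytime_fold_grow[where G = "\<lambda>x. 10"])
    show "polytime (\<lambda>y. step (left (right y)) (right (right y)))"
      unfolding step_def
      by (intro polytime_Node polytime_If polytime_iff polytime_not_Leaf polytime_left
          polytime_right polytime_id)
    show "tsize (step a acc) \<le> tsize acc + 10" for a acc
      using tsize_left_right[of acc] tsize_right[of "left acc"] tsize_enc_bool[of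
          "left (left acc) \<noteq> Leaf"]
      by (auto simp: step_def)
  qed (intro polytime_Node polytime_const assms pbounded_const)+
  then have run: "polytime run"
    unfolding run_def .
  have step: "step u (Node b c) = Node (right b)
      (if u \<noteq> Leaf \<longleftrightarrow> left b \<noteq> Leaf then c else enc_bool (left b \<noteq> Leaf))" for u b c
    by (simp add: step_def)
  \<comment> \<open>The flag \<open>c\<close> breaks ties. Starting it as true turns the strict
    comparison into \<open>\<le>\<close>.\<close>
  have spec: "0 < nval (left (fold step (items a) (Node b c))) \<or>
      right (fold step (items a) (Node b c)) \<noteq> Leaf
      \<longleftrightarrow> nval a < nval b \<or> nval a = nval b \<and> c \<noteq> Leaf" for a b c
  proof (induct a arbitrary: b c)
    case Leaf
    then show ?case by auto
  next
    case (Node u a)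
    show ?case
    proof (cases b)
      case b: Leaf
      show ?thesis unfolding b by (cases "u = Leaf") (simp_all add: step Node(2))
    next
      case b: (Node v w)
      have *: "(1 + 2 * m < 2 * n) = (m < n)" "(2 * m < 1 + 2 * n) = (m \<le> n)" "2 * m \<noteq> 1 + 2 * n"
          "1 + 2 * m \<noteq> 2 * n"
        for m n :: nat by presburger+
      show ?thesis unfolding b
        by (cases "u = Leaf"; cases "v = Leaf") (auto simp: step Node(2) *)
    qed
  qed
  have "polytime (\<lambda>x. enc_bool ((\<exists>b\<in>set (items (left (run x))). b \<noteq> Leaf) \<or> right (run x) \<noteq> Leaf))"
    by (intro polytime_disj polytime_not_Leaf polytime_Bex polytime_right polytime_left
        polytime_id run)
  then show ?thesis
    using spec by (simp add: run_def le_less flip: nval_pos_iff)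
qed

text \<open>Ripple-carry addition, followed by the removal of leading zeros because
  \<open>enc_nat\<close> admits only one representation of each number.\<close>

lemma polytime_nval_add:
  assumes "polytime f" "polytime g"
  shows "polytime (\<lambda>x. enc_nat (nval (f x) + nval (g x)))"
proof -
  define bit :: "tree \<Rightarrow> nat" where "bit = (\<lambda>b. of_bool (b \<noteq> Leaf))"
  \<comment> \<open>The value of a digit list with the most significant digit first, the order in
    which the fold piles up the digits of the sum.\<close>
  define mval where "mval = (\<lambda>bs. nval (enc_list (rev bs)))"
  have nval_app: "nval (enc_list (xs @ ys)) = nval (enc_list xs)
      + 2 ^ length xs * nval (enc_list ys)" for xs ys
    by (induct xs) (auto simp: algebra_simps)
  have mval_Cons: "mval (b # bs) = mval bs + 2 ^ length bs * bit b" for b bs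
    by (simp add: mval_def nval_app bit_def)
  \<comment> \<open>Rebuilds the canonical form from the top digit down; zeros are dropped as long
    as nothing has been kept.\<close>
  define trim where "trim = (\<lambda>b acc. if b \<noteq> Leaf \<or> acc \<noteq> Leaf then Node (enc_bool (b \<noteq> Leaf)) acc
      else Leaf)"
  have enc_nat_Leaf: "enc_nat n = Leaf \<longleftrightarrow> n = 0" for n
    by (subst enc_nat.simps) simp
  have trim: "fold trim bs (enc_nat n) = enc_nat (mval bs + 2 ^ length bs * n)" for bs n
  proof (induct bs arbitrary: n)
    case (Cons b bs)
    have "trim b (enc_nat n) = enc_nat (bit b + 2 * n)"
      unfolding bit_def enc_nat_double by (simp add: trim_def enc_nat_Leaf)
    then show ?case using Cons by (simp add: mval_Cons algebra_simps)
  qed (simp add: mval_def)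
  \<comment> \<open>The accumulator holds the unread digits of \<open>g x\<close>, the carry, and the digits of the sum, the
    most significant one first.\<close>
  define step where "step = (\<lambda>a acc.
     let b = left (left (left acc)); c = right (left acc) in
     Node (Node (right (left (left acc)))
         (enc_bool (a \<noteq> Leaf \<and> (b \<noteq> Leaf \<or> c \<noteq> Leaf) \<or> b \<noteq> Leaf \<and> c \<noteq> Leaf)))
       (Node (enc_bool ((a \<noteq> Leaf \<longleftrightarrow> b \<noteq> Leaf) \<longleftrightarrow> c \<noteq> Leaf)) (right acc)))"
  have step: "step a (Node (Node b c) (enc_list out)) =
      Node (Node (right b) (enc_bool (2 \<le> bit a + bit (left b) + bit c)))
        (enc_list (enc_bool (odd (bit a + bit (left b) + bit c)) # out))" for a b c out
    by (cases "a = Leaf"; cases "left b = Leaf"; cases "c = Leaf") (auto simp: step_def bit_def)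
  have nval_eq: "nval b = bit (left b) + 2 * nval (right b)" for b
    by (cases b) (auto simp: bit_def)
  have bit_enc: "bit (enc_bool P) = of_bool P" for P
    by (simp add: bit_def)
  \<comment> \<open>Conservation law: the digits written, plus the carry and the unread digits
    weighted by the next power of two, keep the same total. The unread digits of the second summand
    are reached by iterating \<open>right\<close>.\<close>
  have spec: "\<exists>c' out'. fold step as (Node (Node b c) (enc_list out)) =
        Node (Node ((right ^^ length as) b) c') (enc_list out') \<and>
      mval out' + 2 ^ length out' * (bit c' + nval ((right ^^ length as) b)) =
      mval out + 2 ^ length out * (bit c + nval b + nval (enc_list as))" for as b c out
  proof (induct as arbitrary: b c out)
    case Nil
    then show ?case by (auto intro!: exI)
  next
    case (Cons a as)
    let ?n = "bit a + bit (left b) + bit c"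
    obtain c' out' where *: "fold step as (Node (Node (right b) (enc_bool (2 \<le> ?n)))
        (enc_list (enc_bool (odd ?n) # out))) =
        Node (Node ((right ^^ length as) (right b)) c') (enc_list out')"
      "mval out' + 2 ^ length out' * (bit c' + nval ((right ^^ length as) (right b))) =
      mval (enc_bool (odd ?n) # out) + 2 ^ length (enc_bool (odd ?n) # out) *
        (bit (enc_bool (2 \<le> ?n)) + nval (right b) + nval (enc_list as))"
      using Cons[of "right b" "enc_bool (2 \<le> ?n)" "enc_bool (odd ?n) # out"] by blast
    have n: "of_bool (odd ?n) + 2 * of_bool (2 \<le> ?n) = ?n"
      by (auto simp: bit_def)
    have "mval (enc_bool (odd ?n) # out) + 2 ^ length (enc_bool (odd ?n) # out) *
        (bit (enc_bool (2 \<le> ?n)) + nval (right b) + nval (enc_list as)) =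
        mval out + 2 ^ length out * ((of_bool (odd ?n) + 2 * of_bool (2 \<le> ?n)) + 2 * nval (right b)
          + 2 * nval (enc_list as))"
      unfolding mval_Cons bit_enc by (simp add: algebra_simps)
    also have "\<dots> = mval out + 2 ^ length out * (bit c + nval b + nval (enc_list (a # as)))"
      unfolding n nval_eq[of b] by (simp add: bit_def algebra_simps)
    finally show ?case
      using * by (intro exI[of _ c'] exI[of _ out']) (simp add: step funpow_swap1)
  qed
  \<comment> \<open>The zeros appended to \<open>f x\<close> make the ripple carry reach the end of \<open>g x\<close>.\<close>
  define as where "as = (\<lambda>x. enc_list (items (f x) @ items (enc_list (map (\<lambda>_. Leaf) (items (g
      x))))))"
  have as: "polytime as" unfolding as_def
    by (intro polytime_append polytime_map assms polytime_const)
  define run where "run = (\<lambda>x. fold step (items (as x)) (Node (Node (g x) Leaf) Leaf))"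
  have "polytime (\<lambda>x. fold ((\<lambda>x. step) x) (items (as x)) (Node (Node (g x) Leaf) Leaf))"
  proof (rule polytime_fold_grow[where G = "\<lambda>x. 20"])
    show "polytime (\<lambda>y. step (left (right y)) (right (right y)))"
      unfolding step_def Let_def
      by (intro polytime_Node polytime_If polytime_iff polytime_conj polytime_disj polytime_Not
          polytime_not_Leaf polytime_left polytime_right polytime_id)
    show "tsize (step a acc) \<le> tsize acc + 20" for a acc
    proof -
      obtain P Q where "step a acc = Node (Node (right (left (left acc))) (enc_bool P)) (Node
          (enc_bool Q) (right acc))"
        by (rule that) (simp only: step_def Let_def)
      then have "tsize (step a acc) \<le> 9 + tsize (right (left (left acc))) + tsize (right acc)"
        using tsize_enc_bool[of P] tsize_enc_bool[of Q] by simp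
      then show ?thesis
        using tsize_left_right[of acc] tsize_left[of "left acc"] tsize_right[of
            "left (left acc)"] by linarith
    qed
  qed (intro polytime_Node polytime_const assms pbounded_const as)+
  then have run: "polytime run"
    unfolding run_def .
  \<comment> \<open>The final carry is put in front as the most significant digit.\<close>
  have val: "fold trim (items (Node (right (left (run x))) (right (run x)))) Leaf =
      enc_nat (nval (f x) + nval (g x))" for x
  proof -
    have "right (enc_list xs) = enc_list (tl xs)" for xs
      by (cases xs) auto
    then have drop: "(right ^^ k) t = enc_list (drop k (items t))" for k t
      by (induct k) (auto simp: drop_Suc tl_drop)
    have z: "nval (enc_list (map (\<lambda>_. Leaf) xs)) = 0" for xs :: "tree list"
      by (induct xs) auto
    have b: "(right ^^ length (items (as x))) (g x) = Leaf"
      by (simp add: drop as_def)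
    obtain c out where "run x = Node (Node Leaf c) (enc_list out)"
      "mval out + 2 ^ length out * bit c = nval (g x) + nval (enc_list (items (as x)))"
      using spec[of "items (as x)" "g x" Leaf "[]"] unfolding b run_def
          by (auto simp: bit_def mval_def)
    then show ?thesis
      using trim[of "c # out" 0] by (simp add: mval_Cons as_def nval_app z add.commute)
  qed
  have "polytime (\<lambda>x. fold ((\<lambda>x. trim) x) (items (Node (right (left (run x))) (right (run x))))
      Leaf)"
  proof (rule polytime_fold_grow[where G = "\<lambda>x. 4"])
    show "polytime (\<lambda>y. trim (left (right y)) (right (right y)))"
      unfolding trim_def
      by (intro polytime_Node polytime_If polytime_disj polytime_const
          polytime_not_Leaf polytime_left polytime_right polytime_id)
    show "tsize (trim a acc) \<le> tsize acc + 4" for a acc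
      using tsize_enc_bool[of "a \<noteq> Leaf"] by (auto simp: trim_def)
  qed (intro polytime_Node polytime_const polytime_left polytime_right pbounded_const run)+
  then show ?thesis by (simp only: val)
qed

section \<open>Arithmetic on number-valued functions\<close>

lemma polytime_comp2:
  assumes F: "polytime (\<lambda>y. F (left y) (right y))" and fg: "polytime f" "polytime g"
  shows "polytime (\<lambda>x. F (f x) (g x))"
  using polytime_comp[OF F polytime_Node[OF fg]] by simp

lemma polytime_add:
  assumes "polytime (\<lambda>x. enc_nat (F x))" "polytime (\<lambda>x. enc_nat (G x))"
  shows "polytime (\<lambda>x. enc_nat (F x + G x))"
  using polytime_nval_add[OF assms] by simp

text \<open>Adding zero brings an arbitrary tree into canonical form.\<close>

lemma polytime_nval:
  assumes "polytime f"
  shows "polytime (\<lambda>x. enc_nat (nval (f x)))"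
  using polytime_nval_add[OF assms polytime_Leaf] by simp

lemma polytime_le:
  assumes "polytime (\<lambda>x. enc_nat (F x))" "polytime (\<lambda>x. enc_nat (G x))"
  shows "polytime (\<lambda>x. enc_bool (F x \<le> G x))"
  using polytime_nval_le[OF assms] by simp

lemma polytime_eq:
  assumes "polytime (\<lambda>x. enc_nat (F x))" "polytime (\<lambda>x. enc_nat (G x))"
  shows "polytime (\<lambda>x. enc_bool (F x = G x))"
  unfolding eq_iff by (intro polytime_conj polytime_le assms)

lemma polytime_If_nat:
  assumes "polytime (\<lambda>x. enc_bool (P x))" "polytime (\<lambda>x. enc_nat (F x))"
      "polytime (\<lambda>x. enc_nat (G x))"
  shows "polytime (\<lambda>x. enc_nat (if P x then F x else G x))"
  using polytime_If[OF assms] unfolding if_distrib .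

text \<open>Horner's scheme over the digits of \<open>F x\<close>, most significant first: double
  the accumulator and add \<open>G x\<close> if the digit is 1. Its value at most doubles per step
  up to that addition, so its length grows linearly.\<close>

lemma polytime_mult:
  assumes "polytime (\<lambda>x. enc_nat (F x))" "polytime (\<lambda>x. enc_nat (G x))"
  shows "polytime (\<lambda>x. enc_nat (F x * G x))"
proof -
  define f where "f = (\<lambda>x. enc_nat (F x))"
  define g where "g = (\<lambda>x. enc_nat (G x))"
  have f: "polytime f" and g: "polytime g" using assms by (simp_all add: f_def g_def)
  have g_less: "nval (g x) < 2 ^ tsize (g x)" for x by (rule nval_less)
  \<comment> \<open>\<open>Node Leaf acc\<close> appends a zero digit at the low end, which doubles
    the value.\<close>
  define step where "step = (\<lambda>x b acc. enc_nat (nval (Node Leaf acc) + nval (if b \<noteq> Leaf then g x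
      else Leaf)))"
  have "polytime (\<lambda>x. fold (step x) (items (enc_list (rev (items (f x))))) Leaf)"
  \<comment> \<open>The invariant says that \<open>m\<close> is at most \<open>2 ^ k - 1\<close>
    times the multiplicand. The summand on the left avoids the subtraction and makes the inequality
    inductive.\<close>
  proof (rule polytime_fold_inv[where B =
      "\<lambda>x. 4 * (tsize (enc_list (rev (items (f x)))) + tsize (g x)) + 1"
        and J = "\<lambda>x k acc. \<exists>m. acc = enc_nat m \<and> m + nval (g x) \<le> 2 ^ k * nval (g x)"])
    show "polytime (\<lambda>y. step (left y) (left (right y)) (right (right y)))"
      unfolding step_def
      by (intro polytime_nval_add polytime_Node polytime_If polytime_not_Leaf polytime_const
          polytime_left polytime_right polytime_id polytime_comp[OF g])
    show "pbounded (\<lambda>x. 4 * (tsize (enc_list (rev (items (f x)))) + tsize (g x)) + 1)"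
      by (intro pbounded_add pbounded_mult pbounded_const polytime_pbounded polytime_rev f g)
    show "\<exists>m. step x b acc = enc_nat m \<and> m + nval (g x) \<le> 2 ^ Suc k * nval (g x)"
      if "\<exists>m. acc = enc_nat m \<and> m + nval (g x) \<le> 2 ^ k * nval (g x)" for x k b acc
      using that by (auto simp: step_def intro!: exI)
    show "tsize acc \<le> 4 * (tsize (enc_list (rev (items (f x)))) + tsize (g x)) + 1"
      if J: "\<exists>m. acc = enc_nat m \<and> m + nval (g x) \<le> 2 ^ k * nval (g x)"
        and k: "k \<le> tsize (enc_list (rev (items (f x))))" for x k acc
    proof -
      obtain m where m: "acc = enc_nat m" "m + nval (g x) \<le> 2 ^ k * nval (g x)"
        using J by blast
      have "2 ^ k * nval (g x) < 2 ^ k * 2 ^ tsize (g x)"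
        using g_less by simp
      then have "m < 2 ^ (k + tsize (g x))"
        using m(2) unfolding power_add by linarith
      then have "tsize acc \<le> 4 * (k + tsize (g x)) + 1"
        unfolding m(1) by (rule tsize_enc_nat)
      then show ?thesis using k by simp
    qed
  qed ((intro polytime_rev polytime_const f exI[of _ 0])+, simp)
  moreover have "fold (step x) (rev (items t)) Leaf = enc_nat (nval t * nval (g x))" for x t
    by (induct t) (auto simp: step_def algebra_simps)
  ultimately show ?thesis by (simp add: f_def g_def)
qed

section \<open>Numbering the entries of a list\<close>

definition enum1 :: "tree \<Rightarrow> tree" where
  "enum1 t = enc_list (map (\<lambda>(k, a). Node (enc_nat k) a) (List.enumerate 1 (items t)))"

lemma tsize_enc_nat_le: "tsize (enc_nat n) \<le> 4 * n + 1"
  by (rule tsize_enc_nat) (rule less_exp)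

lemma polytime_enum1:
  assumes l: "polytime l"
  shows "polytime (\<lambda>x. enum1 (l x))"
proof -
  define step where "step = (\<lambda>a acc. Node (enc_nat (nval (left acc)
      + 1)) (Node (Node (left acc) a) (right acc)))"
  define run where "run = (\<lambda>x. fold step (items (l x)) (Node (enc_nat 1) Leaf))"
  \<comment> \<open>Growth per round: two nodes, an index of size at most
    \<open>4 * tsize (l x) + 1\<close>, and an entry of \<open>l x\<close>.\<close>
  define E where "E = (\<lambda>x. 4 * tsize (l x) + tsize (l x) + 3)"
  have "polytime (\<lambda>x. fold ((\<lambda>x. step) x) (items (l x)) (Node (enc_nat 1) Leaf))"
  proof (rule polytime_fold_inv[where B = "\<lambda>x. 7 + 4 * tsize (l x) + tsize (l x) * E x"
        and J = "\<lambda>x k acc. \<exists>out. acc = Node (enc_nat (k + 1)) out \<and> tsize out \<le> 1 + k * E x"])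
    show "polytime (\<lambda>y. step (left (right y)) (right (right y)))"
      unfolding step_def
      by (intro polytime_Node polytime_add polytime_nval polytime_const polytime_left
          polytime_right polytime_id)
    show "pbounded (\<lambda>x. 7 + 4 * tsize (l x) + tsize (l x) * E x)" unfolding E_def
      by (intro pbounded_add pbounded_mult pbounded_const polytime_pbounded l)
    show "\<exists>out. step a acc = Node (enc_nat (Suc k + 1)) out \<and> tsize out \<le> 1 + Suc k * E x"
      if "\<exists>out. acc = Node (enc_nat (k + 1)) out \<and> tsize out \<le> 1 + k * E x"
        "k < tsize (l x)" "a \<in> set (items (l x))" for x k a acc
      using that tsize_item[OF that(3)] tsize_enc_nat_le[of "k + 1"] by (auto simp: step_def E_def)
    show "tsize acc \<le> 7 + 4 * tsize (l x) + tsize (l x) * E x"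
      if J: "\<exists>out. acc = Node (enc_nat (k + 1)) out \<and> tsize out \<le> 1 + k * E x"
        and k: "k \<le> tsize (l x)" for x k acc
    proof -
      obtain out where "acc = Node (enc_nat (k + 1)) out" "tsize out \<le> 1 + k * E x"
        using J by blast
      then have "tsize acc \<le> 7 + 4 * k + k * E x"
        using tsize_enc_nat_le[of "k + 1"] by simp
      then show ?thesis
        using k mult_le_mono1[OF k, of "E x"] by linarith
    qed
  qed ((intro polytime_Node polytime_const l)+, simp)
  then have "polytime (\<lambda>x. enc_list (rev (items (right (run x)))))"
    unfolding run_def by (intro polytime_rev polytime_right)
  moreover have "fold step xs (Node (enc_nat n) (enc_list out)) = Node (enc_nat (n + length xs))
      (enc_list (rev (map (\<lambda>(k, a). Node (enc_nat k) a) (List.enumerate n xs)) @ out))" for xs n out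
  proof (induct xs arbitrary: n out)
    case (Cons a xs)
    have "step a (Node (enc_nat n) (enc_list out)) = Node (enc_nat (Suc n)) (enc_list (Node
        (enc_nat n) a # out))"
      by (simp add: step_def)
    then show ?case by (simp only: fold_simps Cons) simp
  qed simp
  from this[of _ _ "[]"] have "enc_list (rev (items (right (run x)))) = enum1 (l x)" for x
    by (simp add: run_def enum1_def)
  ultimately show ?thesis by simp
qed

text \<open>A pair of binary numbers encodes a fraction, not necessarily in lowest terms.\<close>

definition fval :: "tree \<Rightarrow> rat" where
  "fval t = of_nat (nval (left t)) / of_nat (nval (right t))"

definition fadd :: "tree \<Rightarrow> tree \<Rightarrow> tree" where
  "fadd s t = Node (enc_nat (nval (left s) * nval (right t) + nval (left t) * nval (right s)))
     (enc_nat (nval (right s) * nval (right t)))"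

definition fsum :: "tree \<Rightarrow> tree" where
  "fsum t = fold fadd (items t) (Node (enc_nat 0) (enc_nat 1))"

definition fle :: "tree \<Rightarrow> tree \<Rightarrow> bool" where
  "fle s t \<longleftrightarrow> nval (left s) * nval (right t) \<le> nval (left t) * nval (right s)"

lemma fval_enc_rat:
  assumes "0 \<le> r"
  shows "fval (enc_rat r) = r" "nval (right (enc_rat r)) > 0"
proof -
  obtain a b where ab: "quotient_of r = (a, b)" by fastforce
  then have "b > 0" by (rule quotient_of_denom_pos)
  moreover have r: "r = of_int a / of_int b" using ab by (rule quotient_of_div)
  ultimately have "a \<ge> 0" using assms by (simp add: zero_le_divide_iff)
  with \<open>b > 0\<close> show "fval (enc_rat r) = r" "nval (right (enc_rat r)) > 0"
    by (simp_all add: fval_def enc_rat_def ab) (simp add: r)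
qed

lemma fval_fadd:
  assumes "nval (right s) > 0" "nval (right t) > 0"
  shows "fval (fadd s t) = fval s + fval t" "nval (right (fadd s t)) > 0"
  using assms by (simp_all add: fadd_def fval_def field_simps)

lemma fval_fsum:
  assumes "\<And>t. t \<in> set ts \<Longrightarrow> nval (right t) > 0"
  shows "fval (fsum (enc_list ts)) = (\<Sum>t\<leftarrow>ts. fval t)" "nval (right (fsum (enc_list ts))) > 0"
proof -
  have "fval (fold fadd ts s) = fval s + (\<Sum>t\<leftarrow>ts. fval t) \<and> nval (right (fold fadd ts s)) > 0"
    if "nval (right s) > 0" for s
    using assms that
  proof (induct ts arbitrary: s)
    case (Cons t ts)
    then show ?case using Cons(1)[of "fadd t s"] fval_fadd[of t s] by simp
  qed simp
  from this[of "Node (enc_nat 0) (enc_nat 1)"]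
  show "fval (fsum (enc_list ts)) = (\<Sum>t\<leftarrow>ts. fval t)" "nval (right (fsum (enc_list ts))) > 0"
    by (simp_all add: fsum_def fval_def)
qed

lemma fle_iff:
  assumes "nval (right s) > 0" "nval (right t) > 0"
  shows "fle s t \<longleftrightarrow> fval s \<le> fval t"
proof -
  have "fle s t \<longleftrightarrow> (of_nat (nval (left s) * nval (right t)) :: rat)
      \<le> of_nat (nval (left t) * nval (right s))"
    unfolding fle_def of_nat_le_iff ..
  also have "\<dots> \<longleftrightarrow> fval s \<le> fval t"
    using assms by (simp add: fval_def divide_simps)
  finally show ?thesis .
qed

lemma polytime_fle:
  "polytime f \<Longrightarrow> polytime g \<Longrightarrow> polytime (\<lambda>x. enc_bool (fle (f x) (g x)))"
  unfolding fle_def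
  by (intro polytime_le polytime_mult polytime_nval polytime_left polytime_right)

text \<open>Denominators are multiplied without reduction, so digit counts add up. After
  \<open>k\<close> summands numerator and denominator have at most
  \<open>1 + k * (tsize (l x) + 1)\<close> digits, which is quadratic in the size of the list at
  worst.\<close>

lemma polytime_fsum:
  assumes l: "polytime l"
  shows "polytime (\<lambda>x. fsum (l x))"
proof -
  have "polytime (\<lambda>x. fold ((\<lambda>x. fadd) x) (items (l x)) (Node (enc_nat 0) (enc_nat 1)))"
  proof (rule polytime_fold_inv[where B = "\<lambda>x. 11 + 8 * (tsize (l x) * (tsize (l x) + 1))"
        and J = "\<lambda>x k acc. \<exists>p q. acc = Node (enc_nat p) (enc_nat q) \<and>
          p < 2 ^ (1 + k * (tsize (l x) + 1)) \<and> q < 2 ^ (1 + k * (tsize (l x) + 1))"])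
    show "polytime (\<lambda>y. fadd (left (right y)) (right (right y)))"
      unfolding fadd_def
      by (intro polytime_Node polytime_add polytime_mult polytime_nval polytime_left
          polytime_right polytime_id)
    show "pbounded (\<lambda>x. 11 + 8 * (tsize (l x) * (tsize (l x) + 1)))"
      by (intro pbounded_add pbounded_mult pbounded_const polytime_pbounded l)
    show "\<exists>p q. fadd a acc = Node (enc_nat p) (enc_nat q) \<and>
          p < 2 ^ (1 + Suc k * (tsize (l x) + 1)) \<and> q < 2 ^ (1 + Suc k * (tsize (l x) + 1))"
      if J: "\<exists>p q. acc = Node (enc_nat p) (enc_nat q) \<and>
          p < 2 ^ (1 + k * (tsize (l x) + 1)) \<and> q < 2 ^ (1 + k * (tsize (l x) + 1))"
        and a: "a \<in> set (items (l x))" for x k a acc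
    proof -
      define M :: nat where "M = 2 ^ (1 + k * (tsize (l x) + 1))"
      define S :: nat where "S = 2 ^ tsize (l x)"
      obtain p q where pq: "acc = Node (enc_nat p) (enc_nat q)" "p < M" "q < M"
        using J unfolding M_def by blast
      \<comment> \<open>The factor \<open>S\<close> accounts for the new fraction, the factor 2 for
        the sum of two cross products in the numerator.\<close>
      have M': "2 ^ (1 + Suc k * (tsize (l x) + 1)) = 2 * (S * M)"
        by (simp add: M_def S_def power_add)
      have "nval (left a) < S" "nval (right a) < S"
        using nval_less[of "left a"] nval_less[of
            "right a"] tsize_left[of a] tsize_right[of a] tsize_item[OF a]
        unfolding S_def by (meson le_trans less_le_trans one_le_numeral power_increasing)+
      with pq have "nval (left a) * q < S * M" "p * nval (right a) < M * S"
          "nval (right a) * q < S * M"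
        by (auto intro!: mult_strict_mono)
      then have "nval (left a) * q + p * nval (right a) < 2 * (S * M)"
          "nval (right a) * q < 2 * (S * M)"
        by (simp_all add: mult.commute)
      moreover have "fadd a acc = Node (enc_nat (nval (left a) * q
          + p * nval (right a))) (enc_nat (nval (right a) * q))"
        by (simp add: fadd_def pq(1))
      ultimately show ?thesis
        unfolding M' by blast
    qed
    show "tsize acc \<le> 11 + 8 * (tsize (l x) * (tsize (l x) + 1))"
      if J: "\<exists>p q. acc = Node (enc_nat p) (enc_nat q) \<and>
          p < 2 ^ (1 + k * (tsize (l x) + 1)) \<and> q < 2 ^ (1 + k * (tsize (l x) + 1))"
        and k: "k \<le> tsize (l x)" for x k acc
    proof -
      obtain p q where pq: "acc = Node (enc_nat p) (enc_nat q)"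
        "p < 2 ^ (1 + k * (tsize (l x) + 1))" "q < 2 ^ (1 + k * (tsize (l x) + 1))"
        using J by blast
      show ?thesis
        using pq(1) tsize_enc_nat[OF pq(2)] tsize_enc_nat[OF pq(3)]
          mult_le_mono1[OF k, of "tsize (l x) + 1"]
        by simp
    qed
    show "\<exists>p q. Node (enc_nat 0) (enc_nat 1) = Node (enc_nat p) (enc_nat q) \<and>
          p < 2 ^ (1 + 0 * (tsize (l x) + 1)) \<and> q < 2 ^ (1 + 0 * (tsize (l x) + 1))" for x
      by (intro exI[of _ 0] exI[of _ 1]) simp
  qed (intro polytime_const l)+
  then show ?thesis unfolding fsum_def .
qed

section \<open>The algorithm\<close>

text \<open>Signals are numbered from 1, so that no row is adjacent to the number 0, which stands for
  the absence of a signal that can be made an accept signal.\<close>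

definition adjacent :: "tree \<Rightarrow> nat \<Rightarrow> bool" where
  "adjacent r j \<longleftrightarrow> (\<exists>e\<in>set (items (enum1 (right (right r)))). nval (left e) = j \<and> right e \<noteq> Leaf)"

text \<open>Its negation means that the state has no alternative to \<open>j\<close>; for adjacent
  rejectable rows this is what being forced to \<open>j\<close> amounts to.\<close>

definition avoidable :: "tree \<Rightarrow> nat \<Rightarrow> bool" where
  "avoidable r j \<longleftrightarrow> (\<exists>e\<in>set (items (enum1 (right (right r)))). nval (left e) \<noteq> j \<and> right e \<noteq> Leaf)"

text \<open>\<open>gain\<close> and \<open>loss\<close> are the tree counterparts of
  \<open>accept_mass\<close> and \<open>forced_mass\<close> for the signal numbered
  \<open>j\<close>.\<close>

definition gain :: "tree \<Rightarrow> nat \<Rightarrow> tree" where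
  "gain rows j = fsum (enc_list (map (\<lambda>r. left (right r))
     (filter (\<lambda>r. left r \<noteq> Leaf \<and> adjacent r j) (items rows))))"

definition loss :: "tree \<Rightarrow> nat \<Rightarrow> tree" where
  "loss rows j = fsum (enc_list (map (\<lambda>r. left (right r))
     (filter (\<lambda>r. \<not> left r \<noteq> Leaf \<and> adjacent r j \<and> \<not> avoidable r j) (items rows))))"

definition better :: "tree \<Rightarrow> nat \<Rightarrow> nat \<Rightarrow> bool" where
  "better rows j b \<longleftrightarrow> fle (loss rows j) (gain rows j) \<and> fle (gain rows b) (gain rows j)"

text \<open>Every row has one entry per signal, so the signal numbers can be read off the first row.
  The initial \<open>Leaf\<close> is the number 0.\<close>

definition best :: "tree \<Rightarrow> tree" where
  "best rows = fold (\<lambda>e b. if better rows (nval (left e)) (nval b) then left e else b)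
     (items (enum1 (right (right (left rows))))) Leaf"

text \<open>Acceptable neighbours of \<open>b\<close> and states without an alternative use
  \<open>b\<close>; every other state takes its first edge that avoids \<open>b\<close>. If
  \<open>b\<close> is 0, this is simply the first edge.\<close>

definition choice :: "tree \<Rightarrow> nat \<Rightarrow> nat" where
  "choice r b = (if left r \<noteq> Leaf \<and> adjacent r b \<or> \<not> avoidable r b then b
     else nval (left (left (enc_list (filter (\<lambda>e. nval (left e) \<noteq> b \<and> right e \<noteq> Leaf)
       (items (enum1 (right (right r)))))))))"

definition output_row :: "tree \<Rightarrow> nat \<Rightarrow> tree" where
  "output_row r b = enc_list (map
     (\<lambda>e. if nval (left e) = choice r b then left (right r) else enc_rat 0)
     (items (enum1 (right (right r)))))"

definition solve :: "tree \<Rightarrow> tree" where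
  "solve rows = enc_list (map (\<lambda>r. output_row r (nval (best rows))) (items rows))"

section \<open>Polynomial time of the algorithm\<close>

lemmas polytime_basic =
  polytime_Node polytime_left polytime_right polytime_id polytime_const polytime_If polytime_If_nat
  polytime_not_Leaf polytime_Not polytime_conj polytime_disj polytime_nval polytime_eq
  polytime_enum1 polytime_fle polytime_fsum

text \<open>Number arguments are handed over in binary and decoded by \<open>nval\<close>, so each
  function below need only be analysed on pairs.\<close>

lemma polytime_nat_arg:
  assumes "polytime (\<lambda>y. F (left y) (nval (right y)))" "polytime f" "polytime (\<lambda>x. enc_nat (J x))"
  shows "polytime (\<lambda>x. F (f x) (J x))"
  using polytime_comp2[of "\<lambda>x y. F x (nval y)" f "\<lambda>x. enc_nat (J x)"] assms by simp

lemma polytime_adjacent: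
  assumes "polytime f" "polytime (\<lambda>x. enc_nat (J x))"
  shows "polytime (\<lambda>x. enc_bool (adjacent (f x) (J x)))"
proof (rule polytime_nat_arg[OF _ assms])
  show "polytime (\<lambda>y. enc_bool (adjacent (left y) (nval (right y))))"
    unfolding adjacent_def by (intro polytime_Bex polytime_basic)
qed

lemma polytime_avoidable:
  assumes "polytime f" "polytime (\<lambda>x. enc_nat (J x))"
  shows "polytime (\<lambda>x. enc_bool (avoidable (f x) (J x)))"
proof (rule polytime_nat_arg[OF _ assms])
  show "polytime (\<lambda>y. enc_bool (avoidable (left y) (nval (right y))))"
    unfolding avoidable_def by (intro polytime_Bex polytime_basic)
qed

lemma polytime_map_filter:
  assumes "polytime (\<lambda>y. g (left y) (right y))" "polytime (\<lambda>y. enc_bool (P (left y) (right y)))"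
      "polytime l"
  shows "polytime (\<lambda>x. enc_list (map (g x) (filter (P x) (items (l x)))))"
  using polytime_map[OF assms(1) polytime_filter[OF assms(2,3)]] by simp

lemma polytime_gain:
  assumes "polytime f" "polytime (\<lambda>x. enc_nat (J x))"
  shows "polytime (\<lambda>x. gain (f x) (J x))"
proof (rule polytime_nat_arg[OF _ assms])
  show "polytime (\<lambda>y. gain (left y) (nval (right y)))"
    unfolding gain_def by (intro polytime_map_filter polytime_adjacent polytime_basic)
qed

lemma polytime_loss:
  assumes "polytime f" "polytime (\<lambda>x. enc_nat (J x))"
  shows "polytime (\<lambda>x. loss (f x) (J x))"
proof (rule polytime_nat_arg[OF _ assms])
  show "polytime (\<lambda>y. loss (left y) (nval (right y)))"
    unfolding loss_def by (intro polytime_map_filter polytime_adjacent polytime_avoidable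
        polytime_basic)
qed

text \<open>The accumulator is always \<open>Leaf\<close> or a number copied from the list of
  numbered signals, so it never outgrows that list.\<close>

lemma polytime_best: "polytime best"
proof -
  have "polytime (\<lambda>rows. fold (\<lambda>e b. if better rows (nval (left e)) (nval b) then left e else b)
     (items (enum1 (right (right (left rows))))) Leaf)"
  proof (rule polytime_fold_inv[where B = "\<lambda>rows. tsize (enum1 (right (right (left rows))))"
        and J = "\<lambda>rows k b. tsize b \<le> tsize (enum1 (right (right (left rows))))"])
    show "polytime (\<lambda>y. if better (left y) (nval (left (left (right y)))) (nval (right (right y)))
        then left (left (right y)) else right (right y))"
      unfolding better_def by (intro polytime_loss polytime_gain polytime_basic)
    show "pbounded (\<lambda>rows. tsize (enum1 (right (right (left rows)))))"
      by (intro polytime_pbounded polytime_basic)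
    show "tsize (if better rows (nval (left e)) (nval b) then left e else b)
        \<le> tsize (enum1 (right (right (left rows))))"
      if "tsize b \<le> tsize (enum1 (right (right (left rows))))"
        "e \<in> set (items (enum1 (right (right (left rows)))))" for rows e b
      using that tsize_left[of e] tsize_item[OF that(2)] by simp
    show "tsize Leaf \<le> tsize (enum1 (right (right (left rows))))" for rows
      by (simp add: Suc_leI)
  qed (intro polytime_basic)+
  then show ?thesis unfolding best_def .
qed

lemma polytime_output_row:
  assumes "polytime f" "polytime (\<lambda>x. enc_nat (J x))"
  shows "polytime (\<lambda>x. output_row (f x) (J x))"
proof (rule polytime_nat_arg[OF _ assms])
  show "polytime (\<lambda>y. output_row (left y) (nval (right y)))"
    unfolding output_row_def choice_def
    by (intro polytime_map polytime_filter polytime_adjacent polytime_avoidable polytime_basic)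
qed

lemma polytime_solve: "polytime solve"
proof -
  have "polytime (\<lambda>y. best (left y))"
    by (intro polytime_comp[OF polytime_best] polytime_basic)
  then show ?thesis
    unfolding solve_def by (intro polytime_map polytime_output_row polytime_basic)
qed

text \<open>The result is either the initial value or an admissible entry. It dominates each
  admissible entry because \<open>f\<close> of the accumulator reaches the value of that entry when
  it is read and never decreases afterwards.\<close>

lemma fold_argmax:
  fixes f :: "nat \<Rightarrow> 'a :: linorder" and ok :: "nat \<Rightarrow> bool"
  defines "step \<equiv> \<lambda>e b. if ok (nval (left e)) \<and> f (nval b) \<le> f (nval (left e)) then left e else b"
  shows "nval (fold step es b) = nval b \<or>
      (\<exists>e\<in>set es. nval (fold step es b) = nval (left e) \<and>
          ok (nval (fold step es b)))" (is "?A es b")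
    and "e \<in> set es \<Longrightarrow> ok (nval (left e)) \<Longrightarrow> f (nval (left e)) \<le> f (nval (fold step es b))"
proof -
  show "?A es b"
  proof (induct es arbitrary: b)
    case (Cons e es)
    have "step e b = b \<or> step e b = left e \<and> ok (nval (left e))" by (simp add: step_def)
    then show ?case using Cons[of "step e b"] by auto
  qed simp
  have mono: "f (nval b) \<le> f (nval (fold step es b))" for b es
  proof (induct es arbitrary: b)
    case (Cons e es)
    have "f (nval b) \<le> f (nval (step e b))" by (simp add: step_def)
    then show ?case using Cons[of "step e b"] by simp
  qed simp
  show "f (nval (left e)) \<le> f (nval (fold step es b))" if "e \<in> set es" "ok (nval (left e))"
    using that(1)
  proof (induct es arbitrary: b)
    case (Cons d es)
    show ?case
    proof (cases "d = e")
      case True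
      have "f (nval (left e)) \<le> f (nval (step e b))" using that(2) by (auto simp: step_def)
      then show ?thesis using mono[of "step e b" es] True by simp
    qed (use Cons in auto)
  qed simp
qed

section \<open>The approximation guarantee\<close>

definition accept_mass :: "('s, 'g) persuasion \<Rightarrow> 'g \<Rightarrow> rat" where
  "accept_mass I \<sigma> = (\<Sum>\<theta>\<in>nb_signal I \<sigma> \<inter> acceptable I. prior I \<theta>)"

definition forced_mass :: "('s, 'g) persuasion \<Rightarrow> 'g \<Rightarrow> rat" where
  "forced_mass I \<sigma> = (\<Sum>\<theta>\<in>{\<theta>\<in>rejectable I. nb_state I \<theta> = {\<sigma>}}. prior I \<theta>)"

definition pure_scheme :: "('s, 'g) persuasion \<Rightarrow> ('s \<Rightarrow> 'g) \<Rightarrow> 's \<times> 'g \<Rightarrow> rat" where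
  "pure_scheme I c = (\<lambda>(\<theta>, \<sigma>). if \<sigma> = c \<theta> then prior I \<theta> else 0)"

context
  fixes I :: "('s, 'g) persuasion"
  assumes inst: "persuasion_instance I"
begin

lemma finite_acceptable: "finite (acceptable I)"
  and finite_rejectable: "finite (rejectable I)"
  and finite_states: "finite (states I)"
  and finite_signals: "finite (signals I)"
  using inst by (auto simp: persuasion_instance_def states_def)

lemma acceptable_rejectable_disjoint: "acceptable I \<inter> rejectable I = {}"
  using inst by (auto simp: persuasion_instance_def)

lemma prior_pos: "\<theta> \<in> states I \<Longrightarrow> prior I \<theta> > 0"
  using inst by (auto simp: persuasion_instance_def)

lemma nb_signal_subset: "nb_signal I \<sigma> \<subseteq> states I"
  using inst by (auto simp: persuasion_instance_def nb_signal_def)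

lemma nb_state_subset: "nb_state I \<theta> \<subseteq> signals I"
  using inst by (auto simp: persuasion_instance_def nb_state_def)

lemma finite_nb: "finite (nb_signal I \<sigma>)" "finite (nb_state I \<theta>)"
  using nb_signal_subset nb_state_subset finite_states finite_signals finite_subset by metis+

lemma nb_iff: "\<sigma> \<in> nb_state I \<theta> \<longleftrightarrow> \<theta> \<in> nb_signal I \<sigma>"
  by (auto simp: nb_signal_def nb_state_def)

lemma accept_mass_nonneg: "0 \<le> accept_mass I \<sigma>"
  unfolding accept_mass_def using nb_signal_subset prior_pos
      by (force intro: sum_nonneg less_imp_le)

lemma prior_nonneg: "\<theta> \<in> nb_signal I \<sigma> \<Longrightarrow> 0 \<le> prior I \<theta>"
  using nb_signal_subset prior_pos by (auto intro: less_imp_le)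

lemma sum_nb_signal:
  "sum f (nb_signal I \<sigma>) =
    sum f (nb_signal I \<sigma> \<inter> acceptable I) + (sum f (nb_signal I \<sigma> \<inter> rejectable I) :: real)"
proof -
  have "nb_signal I \<sigma> = (nb_signal I \<sigma> \<inter> acceptable I) \<union> (nb_signal I \<sigma> \<inter> rejectable I)"
    using nb_signal_subset[of \<sigma>] by (auto simp: states_def)
  then show ?thesis
    using sum.union_disjoint[of "nb_signal I \<sigma> \<inter> acceptable I" "nb_signal I \<sigma> \<inter> rejectable I" f]
      finite_nb acceptable_rejectable_disjoint by auto
qed

lemma scheme_nonneg:
  assumes "signaling_scheme I \<phi>" "\<theta> \<in> nb_signal I \<sigma>"
  shows "0 \<le> \<phi> (\<theta>, \<sigma>)"
  using assms by (auto simp: signaling_scheme_def nb_signal_def Pi_iff)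

lemma scheme_le_prior:
  assumes "signaling_scheme I \<phi>" "\<theta> \<in> states I" "S \<subseteq> nb_state I \<theta>"
  shows "(\<Sum>\<sigma>\<in>S. \<phi> (\<theta>, \<sigma>)) \<le> of_rat (prior I \<theta>)"
proof -
  have "(\<Sum>\<sigma>\<in>S. \<phi> (\<theta>, \<sigma>)) \<le> (\<Sum>\<sigma>\<in>nb_state I \<theta>. \<phi> (\<theta>, \<sigma>))"
    using assms scheme_nonneg[OF assms(1)] finite_nb by (intro sum_mono2) (auto simp: nb_iff)
  then show ?thesis using assms by (simp add: signaling_scheme_def)
qed

section \<open>Upper bound on the optimum\<close>

text \<open>A forced state must send its whole prior along \<open>\<sigma>\<close>, so the forced
  mass is part of the rejectable mass on \<open>\<sigma>\<close>. Acceptance bounds that by the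
  acceptable mass on \<open>\<sigma>\<close>, which cannot exceed the priors of the acceptable
  neighbours.\<close>

lemma accepted_forced_le_mass:
  assumes \<phi>: "signaling_scheme I \<phi>" and \<sigma>: "\<sigma> \<in> accept_signals I \<phi>"
  shows "forced_mass I \<sigma> \<le> accept_mass I \<sigma>"
proof -
  have "of_rat (forced_mass I \<sigma>) = (\<Sum>\<theta>\<in>{\<theta>\<in>rejectable I. nb_state I \<theta> = {\<sigma>}}. \<phi> (\<theta>, \<sigma>))"
    unfolding forced_mass_def of_rat_sum
  proof (intro sum.cong refl)
    fix \<theta> assume "\<theta> \<in> {\<theta>\<in>rejectable I. nb_state I \<theta> = {\<sigma>}}"
    then have "\<theta> \<in> states I" "nb_state I \<theta> = {\<sigma>}" by (auto simp: states_def)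
    moreover from this have "(\<Sum>\<sigma>\<in>nb_state I \<theta>. \<phi> (\<theta>, \<sigma>)) = of_rat (prior I \<theta>)"
      using \<phi> unfolding signaling_scheme_def by blast
    ultimately show "of_rat (prior I \<theta>) = \<phi> (\<theta>, \<sigma>)" by simp
  qed
  also have "\<dots> \<le> (\<Sum>\<theta>\<in>nb_signal I \<sigma> \<inter> rejectable I. \<phi> (\<theta>, \<sigma>))"
    using scheme_nonneg[OF \<phi>] finite_nb by (intro sum_mono2) (auto simp flip: nb_iff)
  also have "\<dots> \<le> (\<Sum>\<theta>\<in>nb_signal I \<sigma> \<inter> acceptable I. \<phi> (\<theta>, \<sigma>))"
    using \<sigma> by (simp add: accept_signals_def)
  also have "\<dots> \<le> of_rat (accept_mass I \<sigma>)"
    unfolding accept_mass_def of_rat_sum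
    using scheme_le_prior[OF \<phi>, of _ "{\<sigma>}"] by (intro sum_mono) (auto simp: nb_iff states_def)
  finally show ?thesis by (simp add: of_rat_less_eq)
qed

text \<open>Acceptance bounds the utility by twice the acceptable mass on accept signals. Regrouped
  by states, each acceptable state contributes at most \<open>a\<close>, and there are at most
  \<open>card (states I)\<close> of them.\<close>

lemma sender_utility_le:
  assumes \<phi>: "signaling_scheme I \<phi>" and "0 \<le> a"
    and a: "\<And>\<sigma>. \<sigma> \<in> signals I \<Longrightarrow> forced_mass I \<sigma> \<le> accept_mass I \<sigma> \<Longrightarrow> accept_mass I \<sigma> \<le> a"
  shows "sender_utility I \<phi> \<le> 2 * real (card (states I)) * of_rat a"
proof -
  let ?S = "accept_signals I \<phi>"
  have S: "finite ?S" "?S \<subseteq> signals I"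
    using finite_signals by (auto simp: accept_signals_def)
  have "sender_utility I \<phi> \<le> (\<Sum>\<sigma>\<in>?S. 2 * (\<Sum>\<theta>\<in>nb_signal I \<sigma> \<inter> acceptable I. \<phi> (\<theta>, \<sigma>)))"
    unfolding sender_utility_def sum_nb_signal by (intro sum_mono) (auto simp: accept_signals_def)
  also have "\<dots> = 2 * (\<Sum>\<sigma>\<in>?S. \<Sum>\<theta>\<in>{\<theta>\<in>acceptable I. \<theta> \<in> nb_signal I \<sigma>}. \<phi> (\<theta>, \<sigma>))"
    unfolding sum_distrib_left[symmetric]
    by (intro arg_cong[where f = "(*) 2"] sum.cong refl) auto
  also have "\<dots> = 2 * (\<Sum>\<theta>\<in>acceptable I. \<Sum>\<sigma>\<in>{\<sigma>\<in>?S. \<theta> \<in> nb_signal I \<sigma>}. \<phi> (\<theta>, \<sigma>))"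
    by (subst sum.swap_restrict[OF S(1) finite_acceptable]) simp
  also have "(\<Sum>\<theta>\<in>acceptable I. \<Sum>\<sigma>\<in>{\<sigma>\<in>?S. \<theta> \<in> nb_signal I \<sigma>}. \<phi> (\<theta>, \<sigma>))
      \<le> (\<Sum>\<theta>\<in>acceptable I. of_rat a)"
  proof (rule sum_mono)
    fix \<theta> assume \<theta>: "\<theta> \<in> acceptable I"
    show "(\<Sum>\<sigma>\<in>{\<sigma>\<in>?S. \<theta> \<in> nb_signal I \<sigma>}. \<phi> (\<theta>, \<sigma>)) \<le> of_rat a"
    proof (cases "{\<sigma>\<in>?S. \<theta> \<in> nb_signal I \<sigma>} = {}")
      case True
      then show ?thesis using \<open>0 \<le> a\<close> by (simp only: sum.empty) simp
    next
      case False
      \<comment> \<open>One accept signal next to \<open>\<theta>\<close> suffices: its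
        \<open>accept_mass\<close> already contains the whole prior of \<open>\<theta>\<close>,
        however that prior is split among signals.\<close>
      then obtain \<sigma> where \<sigma>: "\<sigma> \<in> ?S" "\<theta> \<in> nb_signal I \<sigma>" by auto
      have "(\<Sum>\<sigma>\<in>{\<sigma>\<in>?S. \<theta> \<in> nb_signal I \<sigma>}. \<phi> (\<theta>, \<sigma>)) \<le> of_rat (prior I \<theta>)"
        using \<theta> by (intro scheme_le_prior[OF \<phi>]) (auto simp: nb_iff states_def)
      also have "prior I \<theta> \<le> accept_mass I \<sigma>"
        unfolding accept_mass_def using \<sigma> \<theta> finite_nb
        by (intro member_le_sum) (auto intro: prior_nonneg)
      then have "of_rat (prior I \<theta>) \<le> (of_rat (accept_mass I \<sigma>) :: real)"
        by (simp add: of_rat_less_eq)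
      also have "\<dots> \<le> of_rat a"
        using a[of \<sigma>] accepted_forced_le_mass[OF \<phi> \<sigma>(1)] S \<sigma>(1) by (auto simp: of_rat_less_eq)
      finally show ?thesis .
    qed
  qed
  also have "(\<Sum>\<theta>\<in>acceptable I. of_rat a) \<le> real (card (states I)) * of_rat a"
    using card_mono[OF finite_states, of "acceptable I"] \<open>0 \<le> a\<close>
    by (auto simp: states_def intro!: mult_right_mono)
  finally show ?thesis by simp
qed

section \<open>Schemes that send each state along a single signal\<close>

lemma signaling_scheme_pure:
  assumes c: "\<And>\<theta>. \<theta> \<in> states I \<Longrightarrow> (\<theta>, c \<theta>) \<in> edges I"
  shows "signaling_scheme I (\<lambda>e. of_rat (pure_scheme I c e))"
proof -
  have "prior I \<theta> \<le> 1" if "\<theta> \<in> states I" for \<theta>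
  proof -
    have "prior I \<theta> \<le> (\<Sum>\<theta>\<in>states I. prior I \<theta>)"
      using that finite_states prior_pos by (intro member_le_sum) (auto intro: less_imp_le)
    then show ?thesis using inst by (simp add: persuasion_instance_def)
  qed
  then have "(\<lambda>e. of_rat (pure_scheme I c e)) \<in> edges I \<rightarrow> {0..1::real}"
    using prior_nonneg nb_signal_subset by (fastforce simp: pure_scheme_def nb_signal_def)
  moreover have "(\<Sum>\<sigma>\<in>nb_state I \<theta>. of_rat (pure_scheme I c (\<theta>, \<sigma>))) = (of_rat (prior I \<theta>) :: real)"
    if "\<theta> \<in> states I" for \<theta>
    using c[OF that] finite_nb(2)[of \<theta>]
    by (simp add: pure_scheme_def nb_state_def if_distrib sum.delta cong: if_cong)
  ultimately show ?thesis by (simp add: signaling_scheme_def)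
qed

lemma sender_utility_nonneg: "signaling_scheme I \<phi> \<Longrightarrow> 0 \<le> sender_utility I \<phi>"
  unfolding sender_utility_def by (intro sum_nonneg) (auto intro: scheme_nonneg)

text \<open>By \<open>rej\<close> only forced rejectable states use \<open>b\<close>, while by
  \<open>acc\<close> all its acceptable neighbours do. So \<open>b\<close> is accepted, and the mass
  sent along it alone reaches the bound.\<close>

lemma sender_utility_pure_ge:
  assumes c: "\<And>\<theta>. \<theta> \<in> states I \<Longrightarrow> (\<theta>, c \<theta>) \<in> edges I"
    and b: "b \<in> signals I" "forced_mass I b \<le> accept_mass I b"
    and acc: "\<And>\<theta>. \<theta> \<in> nb_signal I b \<inter> acceptable I \<Longrightarrow> c \<theta> = b"
    and rej: "\<And>\<theta>. \<theta> \<in> rejectable I \<Longrightarrow> c \<theta> = b \<Longrightarrow> nb_state I \<theta> = {b}"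
  shows "sender_utility I (\<lambda>e. of_rat (pure_scheme I c e)) \<ge> of_rat (accept_mass I b)"
proof -
  let ?\<phi> = "\<lambda>e. of_rat (pure_scheme I c e) :: real"
  note \<phi> = signaling_scheme_pure[OF c]
  have A: "(\<Sum>\<theta>\<in>nb_signal I b \<inter> acceptable I. ?\<phi> (\<theta>, b)) = of_rat (accept_mass I b)"
    unfolding accept_mass_def of_rat_sum using acc by (intro sum.cong) (auto simp: pure_scheme_def)
  have "(\<Sum>\<theta>\<in>nb_signal I b \<inter> rejectable I. pure_scheme I c (\<theta>, b)) =
      (\<Sum>\<theta>\<in>{\<theta>\<in>nb_signal I b \<inter> rejectable I. b = c \<theta>}. prior I \<theta>)"
    by (subst sum.inter_filter) (simp_all add: pure_scheme_def finite_nb)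
  also have "\<dots> \<le> forced_mass I b"
    unfolding forced_mass_def using finite_rejectable rej prior_pos
    by (intro sum_mono2) (auto simp: states_def intro: less_imp_le)
  also have "\<dots> \<le> accept_mass I b" by (rule b)
  finally have "(\<Sum>\<theta>\<in>nb_signal I b \<inter> rejectable I. ?\<phi> (\<theta>, b)) \<le> of_rat (accept_mass I b)"
    by (simp only: of_rat_sum[symmetric] of_rat_less_eq)
  then have acc_b: "b \<in> accept_signals I ?\<phi>"
    using b A by (simp add: accept_signals_def)
  have "of_rat (accept_mass I b) \<le> (\<Sum>\<theta>\<in>nb_signal I b. ?\<phi> (\<theta>, b))"
    unfolding sum_nb_signal A using scheme_nonneg[OF \<phi>] by (auto intro: sum_nonneg)
  also have "\<dots> \<le> sender_utility I ?\<phi>"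
    unfolding sender_utility_def using acc_b finite_signals scheme_nonneg[OF \<phi>]
    by (intro member_le_sum[where f = "\<lambda>\<sigma>. \<Sum>\<theta>\<in>nb_signal I \<sigma>. ?\<phi> (\<theta>, \<sigma>)"])
      (auto simp: accept_signals_def intro!: sum_nonneg)
  finally show ?thesis .
qed

text \<open>The alternative \<open>a = 0\<close> covers instances where the search finds no feasible
  signal: the upper bound on \<open>OPT\<close> is then zero, and nonnegativity of the utility
  suffices.\<close>

lemma pure_scheme_approx:
  assumes c: "\<And>\<theta>. \<theta> \<in> states I \<Longrightarrow> (\<theta>, c \<theta>) \<in> edges I"
    and a: "\<And>\<sigma>. \<sigma> \<in> signals I \<Longrightarrow> forced_mass I \<sigma> \<le> accept_mass I \<sigma> \<Longrightarrow> accept_mass I \<sigma> \<le> a"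
    and best: "a = 0 \<or> (\<exists>b\<in>signals I. a = accept_mass I b \<and> forced_mass I b \<le> accept_mass I b \<and>
      (\<forall>\<theta>\<in>nb_signal I b \<inter> acceptable I. c \<theta> = b) \<and>
      (\<forall>\<theta>\<in>rejectable I. c \<theta> = b \<longrightarrow> nb_state I \<theta> = {b}))"
  shows "sender_utility I (\<lambda>e. of_rat (pure_scheme I c e)) \<ge> OPT I / (2 * real (card (states I)))"
proof -
  note \<phi> = signaling_scheme_pure[OF c]
  have "0 \<le> a" using best accept_mass_nonneg by auto
  have "OPT I \<le> 2 * real (card (states I)) * of_rat a"
    unfolding OPT_def
    by (rule cSUP_least) (use \<phi> sender_utility_le[OF _ \<open>0 \<le> a\<close> a] in auto)
  also have "\<dots> \<le> 2 * real (card (states I)) * sender_utility I (\<lambda>e. of_rat (pure_scheme I c e))"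
    using best sender_utility_nonneg[OF \<phi>] sender_utility_pure_ge[OF c]
    by (intro mult_left_mono) auto
  finally have *: "OPT I \<le> 2 * real (card (states I)) * sender_utility I (\<lambda>e. of_rat (pure_scheme
      I c e))" .
  \<comment> \<open>The priors sum to 1, which an empty sum does not; this makes the final division
    legitimate.\<close>
  have "states I \<noteq> {}" using inst by (auto simp: persuasion_instance_def)
  then have "0 < card (states I)" using finite_states by (simp add: card_gt_0_iff)
  then show ?thesis using * by (simp add: divide_le_eq mult.commute)
qed

end

section \<open>Correctness of the algorithm\<close>

context
  fixes I :: "('s, 'g) persuasion" and ss :: "'s list" and gs :: "'g list"
  assumes inst: "persuasion_instance I" and enum: "enumerates I ss gs"
begin

definition row :: "'s \<Rightarrow> tree" where
  "row \<theta> = Node (enc_bool (\<theta> \<in> acceptable I))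
     (Node (enc_rat (prior I \<theta>)) (enc_list (map (\<lambda>\<sigma>. enc_bool ((\<theta>, \<sigma>) \<in> edges I)) gs)))"

abbreviation rows :: tree where
  "rows \<equiv> enc_instance I ss gs"

lemma items_rows: "items rows = map row ss"
  unfolding enc_instance_def items_enc_list by (simp add: row_def)

lemma items_enum1_row: "items (enum1 (right (right (row \<theta>)))) =
    map (\<lambda>i. Node (enc_nat (Suc i)) (enc_bool ((\<theta>, gs ! i) \<in> edges I))) [0..<length gs]"
  by (rule nth_equalityI) (auto simp: enum1_def row_def nth_enumerate_eq)

lemma edge_index:
  assumes "(\<theta>, \<sigma>) \<in> edges I"
  obtains i where "i < length gs" "\<sigma> = gs ! i"
proof -
  have "\<sigma> \<in> set gs" using assms inst enum by (auto simp: persuasion_instance_def enumerates_def)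
  then show thesis using that by (metis in_set_conv_nth)
qed

lemma nth_gs_eq_iff: "i < length gs \<Longrightarrow> j < length gs \<Longrightarrow> gs ! i = gs ! j \<longleftrightarrow> i = j"
  using enum by (simp add: enumerates_def nth_eq_iff_index_eq)

lemma adjacent_row: "adjacent (row \<theta>) j \<longleftrightarrow> (\<exists>i<length gs. j = Suc i \<and> (\<theta>, gs ! i) \<in> edges I)"
  unfolding adjacent_def items_enum1_row by auto

lemma avoidable_row: "avoidable (row \<theta>) j \<longleftrightarrow> (\<exists>i<length gs. j \<noteq> Suc i \<and> (\<theta>, gs ! i) \<in> edges I)"
  unfolding avoidable_def items_enum1_row by auto

text \<open>Only an inclusion, because the state may fail to be adjacent to the signal. With
  adjacency it becomes the equation used in \<open>forced_mass\<close>.\<close>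

lemma not_avoidable_row:
  assumes "i < length gs"
  shows "\<not> avoidable (row \<theta>) (Suc i) \<longleftrightarrow> nb_state I \<theta> \<subseteq> {gs ! i}"
  unfolding avoidable_row nb_state_def using assms edge_index nth_gs_eq_iff by blast

lemma row_simps: "left (row \<theta>) = enc_bool (\<theta> \<in> acceptable I)"
    "left (right (row \<theta>)) = enc_rat (prior I \<theta>)"
  by (simp_all add: row_def)

text \<open>Evaluates \<open>gain\<close> and \<open>loss\<close> at once: distinctness of
  \<open>ss\<close> turns the list sum into a sum over states. The positive denominators are what
  \<open>fle_iff\<close> asks for.\<close>

lemma fval_fsum_rows:
  shows "fval (fsum (enc_list (map (\<lambda>r. left (right r)) (filter P (items rows))))) =
      (\<Sum>\<theta>\<in>{\<theta>\<in>states I. P (row \<theta>)}. prior I \<theta>)"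
    and "nval (right (fsum (enc_list (map (\<lambda>r. left (right r)) (filter P (items rows)))))) > 0"
proof -
  have ss: "distinct ss" "set ss = states I" using enum by (auto simp: enumerates_def)
  have prior: "0 \<le> prior I \<theta>" if "\<theta> \<in> states I" for \<theta>
    using prior_pos[OF inst that] by simp
  let ?ts = "map (\<lambda>\<theta>. enc_rat (prior I \<theta>)) (filter (\<lambda>\<theta>. P (row \<theta>)) ss)"
  have ts: "map (\<lambda>r. left (right r)) (filter P (items rows)) = ?ts"
    by (simp add: items_rows filter_map row_simps comp_def)
  have "nval (right t) > 0" if "t \<in> set ?ts" for t
    using that fval_enc_rat(2) prior ss by auto
  then have *: "fval (fsum (enc_list ?ts)) = (\<Sum>t\<leftarrow>?ts. fval t)"
      "nval (right (fsum (enc_list ?ts))) > 0"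
    using fval_fsum[of ?ts] by blast+
  have "(\<Sum>t\<leftarrow>?ts. fval t) = (\<Sum>\<theta>\<leftarrow>filter (\<lambda>\<theta>. P (row \<theta>)) ss. prior I \<theta>)"
  proof -
    have "map fval ?ts = map (prior I) (filter (\<lambda>\<theta>. P (row \<theta>)) ss)"
      using ss(2) prior fval_enc_rat(1) by simp
    then show ?thesis by (simp only:)
  qed
  also have "\<dots> = (\<Sum>\<theta>\<in>{\<theta>\<in>states I. P (row \<theta>)}. prior I \<theta>)"
    using ss by (subst sum_list_distinct_conv_sum_set) (auto intro!: sum.cong)
  finally show "fval (fsum (enc_list (map (\<lambda>r. left (right r)) (filter P (items rows))))) =
      (\<Sum>\<theta>\<in>{\<theta>\<in>states I. P (row \<theta>)}. prior I \<theta>)"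
    unfolding ts *(1) .
  show "nval (right (fsum (enc_list (map (\<lambda>r. left (right r)) (filter P (items rows)))))) > 0"
    unfolding ts by (rule *(2))
qed

lemma fval_gain_0: "fval (gain rows 0) = 0"
  unfolding gain_def fval_fsum_rows by (simp add: adjacent_row)

lemma fval_gain:
  assumes "i < length gs"
  shows "fval (gain rows (Suc i)) = accept_mass I (gs ! i)"
  unfolding gain_def fval_fsum_rows accept_mass_def
      using assms nb_signal_subset[OF inst, of "gs ! i"]
  by (intro sum.cong) (auto simp: row_simps adjacent_row nb_signal_def)

lemma fval_loss:
  assumes "i < length gs"
  shows "fval (loss rows (Suc i)) = forced_mass I (gs ! i)"
proof -
  have "{\<theta>\<in>states I. \<not> left (row \<theta>) \<noteq> Leaf \<and> adjacent (row \<theta>) (Suc i) \<and>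
      \<not> avoidable (row \<theta>) (Suc i)} =
      {\<theta>\<in>rejectable I. nb_state I \<theta> = {gs ! i}}"
    using assms acceptable_rejectable_disjoint[OF inst]
    by (auto simp: row_simps not_avoidable_row adjacent_row states_def nb_state_def)
  then show ?thesis
    unfolding loss_def fval_fsum_rows forced_mass_def by simp
qed

lemma better_iff: "better rows j b \<longleftrightarrow>
    fval (loss rows j) \<le> fval (gain rows j) \<and> fval (gain rows b) \<le> fval (gain rows j)"
  unfolding better_def by (subst (1 2) fle_iff) (simp_all add: gain_def loss_def fval_fsum_rows(2))

section \<open>The best signal\<close>

definition best_index :: nat where
  "best_index = nval (best rows)"

lemma best_index:
  shows "best_index = 0 \<or> (\<exists>i<length gs. best_index = Suc i \<and>
      forced_mass I (gs ! i) \<le> accept_mass I (gs ! i))"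
    and "\<And>i. i < length gs \<Longrightarrow> forced_mass I (gs ! i) \<le> accept_mass I (gs ! i) \<Longrightarrow>
      accept_mass I (gs ! i) \<le> fval (gain rows best_index)"
proof -
  let ?f = "\<lambda>j. fval (gain rows j)" and ?ok = "\<lambda>j. fval (loss rows j) \<le> fval (gain rows j)"
  \<comment> \<open>A first row must exist for \<open>best\<close> to read the signals from
    it.\<close>
  have "ss \<noteq> []"
    using inst enum by (auto simp: persuasion_instance_def enumerates_def)
  then have "left rows = row (hd ss)"
    using items_rows by (cases rows; cases ss) auto
  \<comment> \<open>Of the numbered entries only the set of their numbers matters from here
    on.\<close>
  then obtain es where es: "best rows = fold (\<lambda>e b. if ?ok (nval (left e)) \<and>
      ?f (nval b) \<le> ?f (nval (left e))
      then left e else b) es Leaf" "(\<lambda>e. nval (left e)) ` set es = Suc ` {..<length gs}"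
    unfolding best_def better_iff by (simp add: items_enum1_row image_image atLeast0LessThan)
  note max = fold_argmax[where f = ?f and ok = ?ok and es = es and b =
      Leaf, folded es(1), folded best_index_def]
  show "best_index = 0 \<or> (\<exists>i<length gs. best_index = Suc i \<and>
      forced_mass I (gs ! i) \<le> accept_mass I (gs ! i))"
  proof (rule disjE[OF max(1)])
    assume "\<exists>e\<in>set es. best_index = nval (left e) \<and> ?ok best_index"
    moreover from this have "best_index \<in> Suc ` {..<length gs}" using es(2) by blast
    ultimately show ?thesis by (auto simp: fval_gain fval_loss)
  qed simp
  show "accept_mass I (gs ! i) \<le> fval (gain rows best_index)"
    if "i < length gs" "forced_mass I (gs ! i) \<le> accept_mass I (gs ! i)" for i
  proof -
    have "Suc i \<in> (\<lambda>e. nval (left e)) ` set es" using es(2) that(1) by blast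
    then obtain e where "e \<in> set es" "Suc i = nval (left e)" by blast
    then show ?thesis using max(2)[of e] that by (simp add: fval_gain fval_loss flip: \<open>Suc i = _\<close>)
  qed
qed

section \<open>The signal sent in each state\<close>

definition chosen :: "'s \<Rightarrow> nat" where
  "chosen \<theta> = choice (row \<theta>) best_index"

text \<open>Avoidability makes the filtered list nonempty, so the outer \<open>left\<close> selects
  a genuine entry rather than the default \<open>Leaf\<close>.\<close>

lemma chosen_first_edge:
  assumes "avoidable (row \<theta>) j"
  obtains i where "i < length gs" "(\<theta>, gs ! i) \<in> edges I" "Suc i \<noteq> j"
    "nval (left (left (enc_list (filter (\<lambda>e. nval (left e) \<noteq> j \<and> right e \<noteq> Leaf)
       (items (enum1 (right (right (row \<theta>))))))))) = Suc i"
proof -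
  let ?xs = "filter (\<lambda>e. nval (left e) \<noteq> j \<and> right e \<noteq> Leaf) (items (enum1 (right (right (row
      \<theta>)))))"
  have "?xs \<noteq> []" using assms by (auto simp: avoidable_def filter_empty_conv)
  then obtain e es where xs: "?xs = e # es" by (cases ?xs) auto
  then have "e \<in> set ?xs" by simp
  then obtain i where "i < length gs" "(\<theta>, gs ! i) \<in> edges I" "Suc i \<noteq> j" "nval (left e) = Suc i"
    unfolding items_enum1_row by auto
  then show thesis using that unfolding xs by simp
qed

text \<open>The delicate case is a state that keeps \<open>best_index\<close> without being adjacent
  to it by assumption. It has some edge, and as no edge avoids \<open>best_index\<close>, that edge
  leads there.\<close>

lemma chosen:
  assumes "\<theta> \<in> states I"
  obtains i where "i < length gs" "(\<theta>, gs ! i) \<in> edges I" "chosen \<theta> = Suc i"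
proof -
  obtain \<sigma> where \<sigma>: "(\<theta>, \<sigma>) \<in> edges I"
    using assms inst unfolding persuasion_instance_def by blast
  obtain k where k: "k < length gs" "\<sigma> = gs ! k"
    using \<sigma> by (rule edge_index)
  have "\<exists>i<length gs. (\<theta>, gs ! i) \<in> edges I \<and> chosen \<theta> = Suc i"
  proof (cases "left (row \<theta>) \<noteq> Leaf \<and> adjacent (row \<theta>) best_index \<or> \<not> avoidable (row \<theta>) best_index")
    case True
    then have c: "chosen \<theta> = best_index" by (simp only: chosen_def choice_def if_True)
    show ?thesis
    proof (cases "adjacent (row \<theta>) best_index")
      case adj: True
      then show ?thesis unfolding c adjacent_row by blast
    next
      case False
      then have "\<not> avoidable (row \<theta>) best_index" using True by blast
      then show ?thesis using k \<sigma> unfolding c avoidable_row by blast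
    qed
  next
    case False
    then have "avoidable (row \<theta>) best_index" by blast
    then show ?thesis
    proof (rule chosen_first_edge)
      fix i assume i: "i < length gs" "(\<theta>, gs ! i) \<in> edges I"
        "nval (left (left (enc_list (filter (\<lambda>e. nval (left e) \<noteq> best_index \<and> right e \<noteq> Leaf)
          (items (enum1 (right (right (row \<theta>))))))))) = Suc i"
      have "chosen \<theta> = Suc i" using False i(3) by (simp only: chosen_def choice_def if_False)
      then show ?thesis using i by blast
    qed
  qed
  then show thesis using that by blast
qed

text \<open>The subtraction converts signal numbers, which start at 1, into list positions.\<close>

definition sent :: "'s \<Rightarrow> 'g" where
  "sent \<theta> = gs ! (chosen \<theta> - 1)"

lemma sent_edge: "\<theta> \<in> states I \<Longrightarrow> (\<theta>, sent \<theta>) \<in> edges I"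
  by (erule chosen) (simp add: sent_def)

lemma sent_eq_iff: "\<theta> \<in> states I \<Longrightarrow> i < length gs \<Longrightarrow> sent \<theta> = gs ! i \<longleftrightarrow> chosen \<theta> = Suc i"
  by (erule chosen) (simp add: sent_def nth_gs_eq_iff)

text \<open>Priors are copied from the input, so they are still in lowest terms as
  \<open>enc_rat\<close> demands. Since \<open>sent \<theta>\<close> is a neighbour of
  \<open>\<theta>\<close>, both sides are zero off the edges.\<close>

lemma solve_eq: "solve rows = enc_scheme I ss gs (pure_scheme I sent)"
proof -
  have "output_row (row \<theta>) best_index = enc_list (map (\<lambda>\<sigma>.
      enc_rat (if (\<theta>, \<sigma>) \<in> edges I then pure_scheme I sent (\<theta>, \<sigma>) else 0)) gs)" (is "_ =
          enc_list (map ?g gs)")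
    if "\<theta> \<in> states I" for \<theta>
  proof -
    have "(if Suc i = chosen \<theta> then enc_rat (prior I \<theta>) else enc_rat 0) = ?g (gs ! i)"
      if i: "i < length gs" for i
    proof (cases "Suc i = chosen \<theta>")
      case True
      then have "sent \<theta> = gs ! i" using sent_eq_iff[OF \<open>\<theta> \<in> states I\<close> i] by simp
      then show ?thesis using True sent_edge[OF \<open>\<theta> \<in> states I\<close>] by (simp add: pure_scheme_def)
    next
      case False
      then have "gs ! i \<noteq> sent \<theta>" using sent_eq_iff[OF \<open>\<theta> \<in> states I\<close> i] by metis
      then show ?thesis using False by (simp add: pure_scheme_def)
    qed
    then have "map (\<lambda>i. if Suc i = chosen \<theta> then enc_rat (prior I \<theta>)
        else enc_rat 0) [0..<length gs] =
        map ?g (map (\<lambda>i. gs ! i) [0..<length gs])"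
      unfolding map_map by (intro map_cong refl) simp
    then show ?thesis
      unfolding output_row_def items_enum1_row row_simps chosen_def[symmetric] map_nth
      by (simp add: comp_def)
  qed
  then have "map (\<lambda>\<theta>. output_row (row \<theta>) best_index) ss = map (\<lambda>\<theta>. enc_list (map (\<lambda>\<sigma>.
      enc_rat (if (\<theta>, \<sigma>) \<in> edges I then pure_scheme I sent (\<theta>, \<sigma>) else 0)) gs)) ss"
    using enum by (intro map_cong refl) (simp add: enumerates_def)
  then show ?thesis
    unfolding solve_def enc_scheme_def items_rows best_index_def[symmetric] map_map comp_def
        by (rule arg_cong)
qed

text \<open>\<open>pure_scheme_approx\<close> is applied with the gain of \<open>best_index\<close>
  as \<open>a\<close>; the index 0 has gain 0 and falls under the alternative
  \<open>a = 0\<close>.\<close>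

lemma sent_approx:
  "sender_utility I (\<lambda>e. of_rat (pure_scheme I sent e)) \<ge> OPT I / (2 * real (card (states I)))"
proof (rule pure_scheme_approx[OF inst sent_edge])
  fix \<sigma> assume "\<sigma> \<in> signals I" "forced_mass I \<sigma> \<le> accept_mass I \<sigma>"
  moreover from this(1) obtain i where "i < length gs" "\<sigma> = gs ! i"
    using enum unfolding enumerates_def by (metis in_set_conv_nth)
  ultimately show "accept_mass I \<sigma> \<le> fval (gain rows best_index)"
    using best_index(2) by simp
next
  show "fval (gain rows best_index) = 0 \<or> (\<exists>b\<in>signals I. fval (gain rows best_index) =
      accept_mass I b \<and>
      forced_mass I b \<le> accept_mass I b \<and>
      (\<forall>\<theta>\<in>nb_signal I b \<inter> acceptable I. sent \<theta> = b) \<and>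
      (\<forall>\<theta>\<in>rejectable I. sent \<theta> = b \<longrightarrow> nb_state I \<theta> = {b}))"
    using best_index(1)
  proof
    assume "best_index = 0"
    then show ?thesis by (simp add: fval_gain_0)
  next
    assume "\<exists>i<length gs. best_index = Suc i \<and> forced_mass I (gs ! i) \<le> accept_mass I (gs ! i)"
    then obtain i where i: "i < length gs" "best_index = Suc i"
        "forced_mass I (gs ! i) \<le> accept_mass I (gs ! i)"
      by blast
    have "sent \<theta> = gs ! i" if "\<theta> \<in> nb_signal I (gs ! i) \<inter> acceptable I" for \<theta>
    proof -
      have "chosen \<theta> = Suc i"
        using that i by (auto simp: chosen_def choice_def row_simps adjacent_row nb_signal_def)
      then show ?thesis by (simp add: sent_def)
    qed
    moreover have "nb_state I \<theta> = {gs ! i}" if "\<theta> \<in> rejectable I" "sent \<theta> = gs ! i" for \<theta>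
    proof -
      have \<theta>: "\<theta> \<in> states I" "\<theta> \<notin> acceptable I"
        using that(1) acceptable_rejectable_disjoint[OF inst] by (auto simp: states_def)
      then have c: "chosen \<theta> = Suc i" using that(2) i(1) sent_eq_iff by simp
      \<comment> \<open>If the state could avoid the best signal, \<open>choice\<close> would have
        moved it to another one, since it is not acceptable.\<close>
      have "\<not> avoidable (row \<theta>) (Suc i)"
      proof
        assume av: "avoidable (row \<theta>) (Suc i)"
        then show False
          by (rule chosen_first_edge) (use av c \<theta> in \<open>auto simp: chosen_def choice_def row_simps
              i(2)\<close>)
      qed
      then have "nb_state I \<theta> \<subseteq> {gs ! i}" using not_avoidable_row i(1) by simp
      moreover have "gs ! i \<in> nb_state I \<theta>"
        using sent_edge[OF \<theta>(1)] that(2) by (simp add: nb_state_def)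
      ultimately show ?thesis by blast
    qed
    moreover have "gs ! i \<in> signals I" using i(1) enum by (auto simp: enumerates_def)
    ultimately show ?thesis using i by (intro disjI2 bexI[of _ "gs ! i"]) (auto simp: fval_gain)
  qed
qed

lemma solve_correct:
  "\<exists>\<psi>. solve rows = enc_scheme I ss gs \<psi> \<and> signaling_scheme I (\<lambda>e. of_rat (\<psi> e)) \<and>
     sender_utility I (\<lambda>e. of_rat (\<psi> e)) \<ge> OPT I / (2 * real (card (states I)))"
  by (intro exI[of _ "pure_scheme I sent"] conjI solve_eq sent_approx signaling_scheme_pure[OF
      inst sent_edge])

end

theorem proposition5p3:
  "\<exists>c. approximation_algorithm (\<lambda>I. 2 * real (card (states I))) c \<and>
       polynomial_time_on valid_inputs c"
proof -
  obtain c p where c: "\<And>x. \<exists>t. runs c x (solve x) t \<and> t \<le> poly p (tsize x)"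
    using polytime_solve by (rule polytime_runs) blast
  have "approximation_algorithm (\<lambda>I. 2 * real (card (states I))) c"
    unfolding approximation_algorithm_def
  proof (intro allI impI)
    fix I :: "(nat, nat) persuasion" and ss gs
    assume I: "persuasion_instance I \<and> enumerates I ss gs"
    obtain t where t: "runs c (enc_instance I ss gs) (solve (enc_instance I ss gs)) t"
      using c by blast
    obtain \<psi> where \<psi>: "solve (enc_instance I ss gs) = enc_scheme I ss gs \<psi>"
      "signaling_scheme I (\<lambda>e. of_rat (\<psi> e))"
      "OPT I / (2 * real (card (states I))) \<le> sender_utility I (\<lambda>e. of_rat (\<psi> e))"
      using solve_correct[of I ss gs] I by blast
    show "\<exists>\<psi> t. runs c (enc_instance I ss gs) (enc_scheme I ss gs \<psi>) t \<and>
        signaling_scheme I (\<lambda>e. of_rat (\<psi> e)) \<and>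
        OPT I / (2 * real (card (states I))) \<le> sender_utility I (\<lambda>e. of_rat (\<psi> e))"
      using t \<psi> by (intro exI[of _ \<psi>] exI[of _ t]) simp
  qed
  \<comment> \<open>The time bound holds on all trees, in particular on encodings of
    instances.\<close>
  moreover have "polynomial_time_on valid_inputs c"
    unfolding polynomial_time_on_def using c by blast
  ultimately show ?thesis by blast
qed

end
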